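(* Let $(V,B)$ be a Steiner system of type $S(t,n,v)$, where $t<n\le v$, let $C=C_{(n,v)}\setminus B$, and let $X_C\subset\mathbb P^n$ be the Complement of the Steiner configuration of points with respect to a collection $\mathcal H=\{H_1,\dots,H_v\}$ of distinct hyperplanes of $\mathbb P^n$ any $n$ of which meet in a point. Then $$\beta_{0,v-n+1}(I_{X_C})=n|B|-\binom{v}{n-1}=n\,\frac{\binom vt}{\binom nt}-\binom{v}{n-1}.$$
   Context: A Steiner system $(V,B)$ of type $S(t,n,v)$ consists of a set $V=\{1,\dots,v\}$ and a collection $B$ of $n$-subsets of $V$ (blocks) such that every $t$-subset of $V$ is contained in a unique block; then $|B|=\binom vt/\binom nt$. $C_{(n,v)}$ denotes the set of all $n$-subsets of $V$. Let $H_j$ be defined by the linear form $\ell_j$ over the field $k$. For an $n$-subset $\sigma$ of $V$ put $P_\sigma=\bigcap_{i\in\sigma}H_i$, a point with ideal $I_{P_\sigma}=(\ell_i:i\in\sigma)\subseteq R=k[x_0,\dots,x_n]$. Then $X_C=\{P_\sigma:\sigma\in C\}$ and $I_{X_C}=\bigcap_{\sigma\in C}I_{P_\sigma}$. The graded Betti numbers $\beta_{i,j}(I)$ are defined by the minimal graded free resolution $\cdots\to\bigoplus_jR(-j)^{\beta_{1,j}(I)}\to\bigoplus_jR(-j)^{\beta_{0,j}(I)}\to R\to R/I\to0$.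
   Formalization: The printed sign is wrong (S(1,3,6) would give −9); the value proved is binom(v,n−1) − n|B| = binom(v,n−1) − n·binom(v,t)/binom(n,t). It is also assumed that no n+1 of the hyperplanes share a point, without which the claim fails (e.g. all hyperplanes through one point). *)

theory Defs
  imports
    "HOL-Analysis.Cartesian_Space"
    "HOL-Library.Poly_Mapping"
    "HOL-Library.Ramsey"
begin

definition steiner_system :: "nat \<Rightarrow> nat \<Rightarrow> nat \<Rightarrow> nat set set \<Rightarrow> bool" where
  "steiner_system t n v B \<longleftrightarrow>
     B \<subseteq> nsets {1..v} n \<and> (\<forall>T \<in> nsets {1..v} t. \<exists>!b. b \<in> B \<and> T \<subseteq> b)"

(* The polynomial ring over 'k with variables indexed by the finite type 'x;
   for CARD('x) = n + 1 this is k[x_0,...,x_n]. *)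
type_synonym ('x, 'k) mpoly = "('x \<Rightarrow>\<^sub>0 nat) \<Rightarrow>\<^sub>0 'k"

definition homogeneous :: "nat \<Rightarrow> ('x::finite, 'k::zero) mpoly \<Rightarrow> bool" where
  "homogeneous d p \<longleftrightarrow>
     (\<forall>m \<in> Poly_Mapping.keys p. (\<Sum>x\<in>UNIV. Poly_Mapping.lookup m x) = d)"

(* The ideal generated by all variables: polynomials with zero constant term. *)
definition irrelevant_ideal :: "('x, 'k::zero) mpoly set" where
  "irrelevant_ideal = {p. Poly_Mapping.lookup p 0 = 0}"

definition linear_form :: "'k::field ^ 'x::finite \<Rightarrow> ('x, 'k) mpoly" where
  "linear_form a = (\<Sum>x\<in>UNIV. Poly_Mapping.single (Poly_Mapping.single x 1) (a $ x))"

definition ideal_generated :: "'r::comm_ring_1 set \<Rightarrow> 'r set" where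
  "ideal_generated S = module.span (*) S"

(* Points of projective space are the lines through the origin of 'k ^ 'x. *)
definition projective_space :: "('k::field ^ 'x::finite) set set" where
  "projective_space = {vec.span {p} | p. p \<noteq> 0}"

definition hyperplane :: "'k::field ^ 'x::finite \<Rightarrow> ('k ^ 'x) set set" where
  "hyperplane a = {P \<in> projective_space. \<forall>p\<in>P. (\<Sum>x\<in>UNIV. a $ x * p $ x) = 0}"

(* Besides "any n of the hyperplanes meet in a point", this contains the other half of the
   usual convention for star configurations: no n + 1 of them have a common point. Given the
   first half, the second says that different n-subsets define different points. *)
definition meet_properly :: "nat \<Rightarrow> (nat \<Rightarrow> 'p set) \<Rightarrow> nat set \<Rightarrow> bool" where
  "meet_properly n H V \<longleftrightarrow>
     (\<forall>\<sigma> \<in> nsets V n. \<exists>P. (\<Inter>i\<in>\<sigma>. H i) = {P}) \<and>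
     (\<forall>\<sigma> \<in> nsets V (n + 1). (\<Inter>i\<in>\<sigma>. H i) = {})"

definition point_ideal :: "(nat \<Rightarrow> 'k::field ^ 'x::finite) \<Rightarrow> nat set \<Rightarrow> ('x, 'k) mpoly set" where
  "point_ideal a \<sigma> = ideal_generated ((\<lambda>i. linear_form (a i)) ` \<sigma>)"

(* For empty C the intersection is the whole ring. *)
definition configuration_ideal ::
    "(nat \<Rightarrow> 'k::field ^ 'x::finite) \<Rightarrow> nat set set \<Rightarrow> ('x, 'k) mpoly set" where
  "configuration_ideal a C = (\<Inter>\<sigma>\<in>C. point_ideal a \<sigma>)"

(* For b :: nat => nat, the graded free module (+)_j R(-j)^(b j): its basis consists of the
   pairs (j, r) with r < b j, and (j, r) has degree j. A vector is the finitely supported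
   function giving its coordinates. *)
definition basis :: "(nat \<Rightarrow> nat) \<Rightarrow> (nat \<times> nat) set" where
  "basis b = {(j, r). r < b j}"

definition free_module :: "(nat \<Rightarrow> nat) \<Rightarrow> (nat \<times> nat \<Rightarrow>\<^sub>0 'r::zero) set" where
  "free_module b = {f. Poly_Mapping.keys f \<subseteq> basis b}"

definition homogeneous_vector ::
    "nat \<Rightarrow> (nat \<times> nat \<Rightarrow>\<^sub>0 ('x::finite, 'k::zero) mpoly) \<Rightarrow> bool" where
  "homogeneous_vector d f \<longleftrightarrow>
     (\<forall>e \<in> Poly_Mapping.keys f. fst e \<le> d \<and> homogeneous (d - fst e) (Poly_Mapping.lookup f e))"

(* The R-linear maps with prescribed values on the basis, into R and into a free module. *)
definition extend_to_ring ::
    "(nat \<times> nat \<Rightarrow> 'r) \<Rightarrow> (nat \<times> nat \<Rightarrow>\<^sub>0 'r) \<Rightarrow> 'r::comm_ring_1" where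
  "extend_to_ring g f = (\<Sum>e \<in> Poly_Mapping.keys f. Poly_Mapping.lookup f e * g e)"

definition extend_to_free ::
    "(nat \<times> nat \<Rightarrow> nat \<times> nat \<Rightarrow>\<^sub>0 'r) \<Rightarrow> (nat \<times> nat \<Rightarrow>\<^sub>0 'r) \<Rightarrow> nat \<times> nat \<Rightarrow>\<^sub>0 'r::comm_ring_1"
  where
  "extend_to_free g f =
     (\<Sum>e \<in> Poly_Mapping.keys f.
        Poly_Mapping.map (\<lambda>c. Poly_Mapping.lookup f e * c) (g e))"

(* ... -> F_2 -> F_1 -> F_0 -> R -> R/I -> 0 with F_i = (+)_j R(-j)^(beta i j), where eps gives
   the map F_0 -> R and delta i the map F_(i+1) -> F_i on basis elements. Minimality asks that
   F_(i+1) be mapped into m F_i, with m the irrelevant ideal; it is not asked of F_0 -> R, whose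
   image is I, so that the definition also gives the Betti numbers of I = R. *)
definition minimal_graded_free_resolution ::
    "('x::finite, 'k::field) mpoly set \<Rightarrow> (nat \<Rightarrow> nat \<Rightarrow> nat) \<Rightarrow>
     (nat \<times> nat \<Rightarrow> ('x, 'k) mpoly) \<Rightarrow>
     (nat \<Rightarrow> nat \<times> nat \<Rightarrow> nat \<times> nat \<Rightarrow>\<^sub>0 ('x, 'k) mpoly) \<Rightarrow> bool" where
  "minimal_graded_free_resolution I \<beta> \<epsilon> \<delta> \<longleftrightarrow>
     (\<forall>e \<in> basis (\<beta> 0). homogeneous (fst e) (\<epsilon> e)) \<and>
     (\<forall>i. \<forall>e \<in> basis (\<beta> (i + 1)).
        \<delta> i e \<in> free_module (\<beta> i) \<and> homogeneous_vector (fst e) (\<delta> i e)) \<and>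
     extend_to_ring \<epsilon> ` free_module (\<beta> 0) = I \<and>
     extend_to_free (\<delta> 0) ` free_module (\<beta> 1) =
       {f \<in> free_module (\<beta> 0). extend_to_ring \<epsilon> f = 0} \<and>
     (\<forall>i. extend_to_free (\<delta> (i + 1)) ` free_module (\<beta> (i + 2)) =
       {f \<in> free_module (\<beta> (i + 1)). extend_to_free (\<delta> i) f = 0}) \<and>
     (\<forall>i. \<forall>e \<in> basis (\<beta> (i + 1)). \<forall>c. Poly_Mapping.lookup (\<delta> i e) c \<in> irrelevant_ideal)"

definition graded_betti :: "('x::finite, 'k::field) mpoly set \<Rightarrow> nat \<Rightarrow> nat \<Rightarrow> nat" where
  "graded_betti I i j =
     (THE b. \<exists>\<beta> \<epsilon> \<delta>. minimal_graded_free_resolution I \<beta> \<epsilon> \<delta> \<and> \<beta> i j = b)"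

end

(* Over a field k let F_b be the product of the v - n forms l_i with i outside an n-subset b, and
   let G_S be the analogous product of v - n + 1 forms for an (n - 1)-subset S. Evaluation at the
   points P_b shows that the F_b are linearly independent, and counting monomials shows that they
   form a basis of the forms of degree v - n. In the same way the G_S together with the L_b F_b,
   where L_b is a linear form not vanishing at P_b, form a basis in degree v - n + 1; the G_S are
   separated by restricting to the lines cut out by n - 1 hyperplanes. Hence the ideal I of X_C has
   basis F_b (b in B) in degree v - n, and basis G_S, L_b F_b (b in B) in degree v - n + 1. The part
   of I in degree v - n + 1 generated from degree v - n is spanned by the L_b F_b and the
   l_i F_b = G_(b - i) with i in b. Two blocks share at most t - 1 <= n - 2 points, so all b - i are
   distinct, and choose(v, n - 1) - n |B| of the G_S remain as minimal generators.

   Graded Betti numbers are well defined because minimal resolutions can be built degree by degree: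
   one picks generators that extend a basis of the k-space of decomposable elements. Only finite
   dimension in each degree is needed, so that Hilbert's basis theorem is not. *)
theory Submission
  imports Defs "HOL-Computational_Algebra.Polynomial"
begin

section \<open>The grading of the polynomial ring\<close>

text \<open>The definite description in \<open>graded_betti\<close> has a value only if some minimal
  resolution exists, so a whole one is constructed although only its first module is wanted.
  Uniqueness there is graded Nakayama: in every minimal cover, the number of generators of degree j
  is the dimension of I_j modulo what the variables produce from I_(j-1). Everything thus comes down
  to two dimensions in degree v - n + 1: |B| + choose(v, n - 1) for I and |B| + n |B| for its
  decomposable part.

  The counts fit because there are choose(v, n) monomials of degree v - n in n + 1 variables, and
  Pascal's rule gives choose(v, n) + choose(v, n - 1) = choose(v + 1, n) one degree higher. The
  separation is triangular: every G_S vanishes at all P_b, so the points eliminate the L_b F_b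
  first; only then do the lines isolate the G_S, since L_b F_b is nonzero on the line of S if S lies
  in b. The field may be finite, so a line may have no point off the other hyperplanes; evaluations
  therefore take values in univariate polynomials.\<close>

lemma poly_mapping_sum_single:
  "p = (\<Sum>m\<in>Poly_Mapping.keys p. Poly_Mapping.single m (Poly_Mapping.lookup p m))"
  by (rule poly_mapping_eqI)
    (auto simp: lookup_sum lookup_single when_def in_keys_iff)

definition mdeg :: "('x::finite \<Rightarrow>\<^sub>0 nat) \<Rightarrow> nat" where
  "mdeg m = (\<Sum>x\<in>UNIV. Poly_Mapping.lookup m x)"

lemma mdeg_add: "mdeg (m + m') = mdeg m + mdeg m'"
  by (simp add: mdeg_def lookup_add sum.distrib)

lemma mdeg_zero [simp]: "mdeg 0 = 0"
  by (simp add: mdeg_def)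

lemma mdeg_single [simp]: "mdeg (Poly_Mapping.single x k) = k"
  by (simp add: mdeg_def lookup_single when_def)

lemma mdeg_eq_0_iff [simp]: "mdeg m = 0 \<longleftrightarrow> m = 0"
  by (auto simp: mdeg_def intro: poly_mapping_eqI)

text \<open>Homogeneity is used as the equation \<open>hpart d p = p\<close>, which can serve for
  rewriting and holds for p = 0 in every degree.\<close>

definition hpart :: "nat \<Rightarrow> ('x::finite, 'k::zero) mpoly \<Rightarrow> ('x, 'k) mpoly" where
  "hpart d p = Poly_Mapping.mapp (\<lambda>m c. c when mdeg m = d) p"

lemma lookup_hpart: "Poly_Mapping.lookup (hpart d p) m = (Poly_Mapping.lookup p m when mdeg m = d)"
  by (simp add: hpart_def lookup_mapp when_def in_keys_iff)

lemma hpart_add: "hpart d (p + q) = hpart d p + hpart d (q :: ('x::finite, 'k::monoid_add) mpoly)"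
  by (rule poly_mapping_eqI) (simp add: lookup_hpart lookup_add when_def)

lemma hpart_zero [simp]: "hpart d 0 = 0"
  by (rule poly_mapping_eqI) (simp add: lookup_hpart)

lemma hpart_sum:
  "hpart d (\<Sum>i\<in>A. f i) = (\<Sum>i\<in>A. hpart d (f i ::
      ('x::finite, 'k::comm_monoid_add) mpoly))"
  by (induction A rule: infinite_finite_induct) (auto simp: hpart_add)

lemma hpart_hpart: "hpart d (hpart e p) = (if d = e then hpart d p else 0)"
  by (auto intro!: poly_mapping_eqI simp: lookup_hpart when_def)

lemma hpart_single:
  "hpart d (Poly_Mapping.single m c) = (if mdeg m = d then Poly_Mapping.single m c else 0)"
  by (auto intro!: poly_mapping_eqI simp: lookup_hpart lookup_single when_def)

lemma hpart_0: "hpart 0 p = Poly_Mapping.single 0 (Poly_Mapping.lookup p 0)"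
  by (auto intro!: poly_mapping_eqI simp: lookup_hpart lookup_single when_def)

lemma homogeneous_iff_hpart: "homogeneous d p \<longleftrightarrow> hpart d p = p"
  by (auto simp: homogeneous_def poly_mapping_eq_iff fun_eq_iff lookup_hpart when_def
      in_keys_iff mdeg_def[symmetric])

lemma hpart_eq_self_keys: "hpart d p = p \<Longrightarrow> m \<in> Poly_Mapping.keys p
    \<Longrightarrow> mdeg m = d"
  by (metis homogeneous_def homogeneous_iff_hpart mdeg_def)

lemma sum_hpart: "\<exists>N. p = (\<Sum>d<N. hpart d (p :: ('x::finite, 'k::comm_monoid_add) mpoly))"
proof -
  obtain N where N: "\<forall>m\<in>Poly_Mapping.keys p. mdeg m < N"
    using finite_nat_set_iff_bounded[of "mdeg ` Poly_Mapping.keys p"] by auto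
  have "Poly_Mapping.lookup p m = Poly_Mapping.lookup (\<Sum>d<N. hpart d p) m" for m
    using N by (auto simp: lookup_sum lookup_hpart when_def in_keys_iff)
  then show ?thesis by (blast intro: poly_mapping_eqI)
qed

text \<open>Additivity in both factors reduces this to monomials, whose degrees add. With one factor
  homogeneous this is the shape demanded by \<open>part_scale\<close> below.\<close>

lemma hpart_mult:
  fixes q g :: "('x::finite, 'k::comm_ring_1) mpoly"
  assumes "hpart e g = g"
  shows "hpart j (q * g) = (if e \<le> j then hpart (j - e) q * g else 0)"
proof -
  have g: "mdeg m = e" if "m \<in> Poly_Mapping.keys g" for m
    using assms that by (rule hpart_eq_self_keys)
  have single: "hpart j (Poly_Mapping.single m c * g) =
      (if e \<le> j then hpart (j - e) (Poly_Mapping.single m c) * g else 0)" for m and c :: 'k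
  proof -
    have "hpart j (Poly_Mapping.single m c * g) =
        (\<Sum>m'\<in>Poly_Mapping.keys g. hpart j
          (Poly_Mapping.single m c * Poly_Mapping.single m' (Poly_Mapping.lookup g m')))"
      by (subst (1) poly_mapping_sum_single[of g]) (simp add: sum_distrib_left hpart_sum)
    also have "\<dots> = (\<Sum>m'\<in>Poly_Mapping.keys g.
          (if mdeg m + e = j then Poly_Mapping.single m c else 0) *
             Poly_Mapping.single m' (Poly_Mapping.lookup g m'))"
      by (rule sum.cong) (auto simp: mult_single hpart_single mdeg_add g)
    also have "\<dots> = (if mdeg m + e = j then Poly_Mapping.single m c else 0) * g"
      by (simp add: sum_distrib_left[symmetric] flip: poly_mapping_sum_single)
    finally show ?thesis by (auto simp: hpart_single)
  qed
  have "hpart j (q * g) = (\<Sum>m\<in>Poly_Mapping.keys q.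
          hpart j (Poly_Mapping.single m (Poly_Mapping.lookup q m) * g))"
    by (subst poly_mapping_sum_single[of q]) (simp add: sum_distrib_right hpart_sum)
  also have "\<dots> = (if e \<le> j then (\<Sum>m\<in>Poly_Mapping.keys q.
          hpart (j - e) (Poly_Mapping.single m (Poly_Mapping.lookup q m))) * g else 0)"
    by (simp add: single sum_distrib_right)
  also have "\<dots> = (if e \<le> j then hpart (j - e) q * g else 0)"
    by (simp flip: hpart_sum poly_mapping_sum_single)
  finally show ?thesis .
qed

lemma hpart_mult_homogeneous:
  "hpart d p = p \<Longrightarrow> hpart e q = q \<Longrightarrow> hpart (d + e) (p * q)
      = p * (q :: ('x::finite, 'k::comm_ring_1) mpoly)"
  by (simp add: hpart_mult)

section \<open>Monomials of a fixed degree\<close>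

abbreviation var :: "'x \<Rightarrow> ('x::finite, 'k::comm_ring_1) mpoly" where
  "var x \<equiv> Poly_Mapping.single (Poly_Mapping.single x (Suc 0)) 1"

abbreviation monomials :: "nat \<Rightarrow> ('x::finite \<Rightarrow>\<^sub>0 nat) set" where
  "monomials d \<equiv> {m. mdeg m = d}"

lemma finite_monomials: "finite (monomials d :: ('x::finite \<Rightarrow>\<^sub>0 nat) set)"
proof (rule finite_imageD)
  have "finite (Pi\<^sub>E (UNIV :: 'x set) (\<lambda>_. {..d}))"
    by (intro finite_PiE) auto
  moreover have "Poly_Mapping.lookup ` monomials d
      \<subseteq> Pi\<^sub>E (UNIV :: 'x set) (\<lambda>_. {..d})"
    unfolding mdeg_def by (auto intro: member_le_sum)
  ultimately show "finite (Poly_Mapping.lookup ` monomials d :: ('x \<Rightarrow> nat) set)"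
    by (rule rev_finite_subset)
  show "inj_on Poly_Mapping.lookup (monomials d)"
    by (rule inj_onI) (erule poly_mapping_eq_iff[THEN iffD2])
qed

lemma monomial_decompose:
  fixes m :: "'x::finite \<Rightarrow>\<^sub>0 nat"
  assumes "mdeg m = Suc d"
  obtains x m' where "m = Poly_Mapping.single x 1 + m'" "mdeg m' = d"
proof -
  obtain x where x: "Poly_Mapping.lookup m x \<noteq> 0"
    using assms by (force simp: mdeg_def)
  have "m = Poly_Mapping.single x 1 + (m - Poly_Mapping.single x 1)"
    by (rule poly_mapping_eqI)
        (use x in \<open>auto simp: lookup_add lookup_minus lookup_single when_def\<close>)
  moreover from this have "mdeg (m - Poly_Mapping.single x 1) = d"
    by (metis assms mdeg_add mdeg_single diff_Suc_1 plus_1_eq_Suc)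
  ultimately show thesis using that by blast
qed

section \<open>Linear algebra: families that are independent modulo a subspace\<close>

context vector_space
begin

text \<open>The last hypothesis is independence modulo \<open>span D\<close>. Working with families
  makes injectivity a conclusion: a repeated vector would allow the coefficients 1 and -1.\<close>

lemma independent_Un_family:
  assumes D: "independent D" "finite D" and A: "finite A"
    and u: "\<And>u. (\<Sum>i\<in>A. scale (u i) (g i)) \<in> span D
        \<Longrightarrow> \<forall>i\<in>A. u i = 0"
  shows "inj_on g A \<and> g ` A \<inter> D = {} \<and> independent (D \<union> g ` A)"
proof (intro conjI)
  show inj: "inj_on g A"
  proof (rule inj_onI, rule ccontr)
    fix i j assume ij: "i \<in> A" "j \<in> A" "g i = g j" "i \<noteq> j"
    define u where "u k = (if k = i then 1 else if k = j then -1 else 0 :: 'a)" for k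
    have "(\<Sum>k\<in>A. scale (u k) (g k)) = (\<Sum>k\<in>{i, j}. scale (u k) (g k))"
      by (rule sum.mono_neutral_right) (use A ij in \<open>auto simp: u_def\<close>)
    also have "\<dots> = 0"
      using ij by (simp add: u_def)
    finally have "u i = 0"
      using u[of u] ij by (simp add: span_zero)
    then show False by (simp add: u_def)
  qed
  show disj: "g ` A \<inter> D = {}"
  proof (rule ccontr)
    assume "g ` A \<inter> D \<noteq> {}"
    then obtain i where i: "i \<in> A" "g i \<in> D" by auto
    have "(\<Sum>k\<in>A. scale (if k = i then 1 else 0) (g k)) = (\<Sum>k\<in>{i}. scale (if k
        = i then 1 else 0) (g k))"
      by (rule sum.mono_neutral_right) (use A i in auto)
    also have "\<dots> \<in> span D" using i by (simp add: span_base)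
    finally show False
      using u[of "\<lambda>k. if k = i then 1 else 0"] i by auto
  qed
  show "independent (D \<union> g ` A)"
  proof (rule independent_if_scalars_zero)
    show "finite (D \<union> g ` A)" using D A by simp
    fix f x assume f: "(\<Sum>x\<in>D \<union> g ` A. scale (f x) x) = 0" and x: "x
        \<in> D \<union> g ` A"
    have "(\<Sum>x\<in>D \<union> g ` A. scale (f x) x)
        = (\<Sum>x\<in>D. scale (f x) x) + (\<Sum>i\<in>A. scale (f (g i)) (g i))"
      using D A disj inj by (subst sum.union_disjoint) (auto simp: sum.reindex)
    then have eq: "(\<Sum>i\<in>A. scale (f (g i)) (g i)) = - (\<Sum>x\<in>D. scale (f x) x)"
      using f by (simp add: eq_neg_iff_add_eq_0 add.commute)
    have "(\<Sum>i\<in>A. scale (f (g i)) (g i)) \<in> span D"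
      unfolding eq by (intro span_neg span_sum span_scale span_base)
    then have z: "\<forall>i\<in>A. f (g i) = 0" by (rule u)
    then have "(\<Sum>x\<in>D. scale (f x) x) = 0" using eq by simp
    then have "\<forall>x\<in>D. f x = 0"
      using independentD[OF D(1) D(2) subset_refl, of f] by blast
    then show "f x = 0" using x z by auto
  qed
qed

lemma independent_family_imp_coeff_zero:
  assumes E: "independent E" and A: "finite A" "inj_on g A" "g ` A \<subseteq> E - D" and D: "D
      \<subseteq> E"
    and u: "(\<Sum>i\<in>A. scale (u i) (g i)) \<in> span D" and i: "i \<in> A"
  shows "u i = 0"
proof -
  obtain t r where t: "finite t" "t \<subseteq> D" and eq: "(\<Sum>i\<in>A. scale (u i) (g i))
      = (\<Sum>a\<in>t. scale (r a) a)"
    using u unfolding span_explicit by blast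
  \<comment> \<open>Both expansions are moved to one side. \<open>t\<close> lies in \<open>D\<close>
    and the family outside \<open>D\<close>, so the cases do not clash, and independence of
    \<open>E\<close> makes \<open>c\<close> vanish.\<close>
  define c where "c a = (if a \<in> t then - r a else u (the_inv_into A g a))" for a
  have "(\<Sum>a\<in>t \<union> g ` A. scale (c a) a)
      = (\<Sum>a\<in>t. scale (c a) a) + (\<Sum>i\<in>A. scale (c (g i)) (g i))"
    using A t by (subst sum.union_disjoint) (auto simp: sum.reindex)
  also have "(\<Sum>a\<in>t. scale (c a) a) = - (\<Sum>a\<in>t. scale (r a) a)"
    by (simp add: c_def sum_negf)
  also have "(\<Sum>i\<in>A. scale (c (g i)) (g i)) = (\<Sum>i\<in>A. scale (u i) (g i))"
  proof (rule sum.cong)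
    fix k assume "k \<in> A"
    then have "g k \<notin> t" "the_inv_into A g (g k) = k"
      using A t by (auto simp: the_inv_into_f_f)
    then show "scale (c (g k)) (g k) = scale (u k) (g k)" by (simp add: c_def)
  qed simp
  finally have "(\<Sum>a\<in>t \<union> g ` A. scale (c a) a) = 0" using eq by simp
  then have "c (g i) = 0"
    using independentD[OF E, of "t \<union> g ` A" c "g i"] A t D i by blast
  moreover have "g i \<notin> t" using A t i by auto
  ultimately show ?thesis using A i by (simp add: c_def the_inv_into_f_f)
qed

text \<open>A vector of \<open>span T\<close> outside \<open>span S\<close> would enlarge
  \<open>S\<close> to an independent set with more elements than \<open>T\<close>. This is how
  counting turns independence into spanning.\<close>

lemma independent_card_ge_spans:
  assumes "finite T" "independent S" "S \<subseteq> span T" "card T \<le> card S"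
  shows "span T \<subseteq> span S"
proof
  fix x assume x: "x \<in> span T"
  show "x \<in> span S"
  proof (rule ccontr)
    assume n: "x \<notin> span S"
    then have "independent (insert x S)" using assms by (simp add: independent_insertI)
    moreover have "insert x S \<subseteq> span T" using x assms by simp
    ultimately have "finite (insert x S) \<and> card (insert x S) \<le> card T"
      by (intro independent_span_bound[OF assms(1)])
    moreover have "x \<notin> S" using n span_base by blast
    ultimately show False using assms(4) by auto
  qed
qed

text \<open>The coefficients are indexed by \<open>A\<close> and not by the image, so that an
  evaluation can single out one index.\<close>

lemma span_image_family:
  assumes "finite A" "f \<in> span (g ` A)"
  obtains u where "f = (\<Sum>i\<in>A. scale (u i) (g i))"
proof -
  let ?R = "range (\<lambda>u. \<Sum>i\<in>A. scale (u i) (g i))"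
  have "span (g ` A) \<subseteq> ?R"
  proof (rule span_minimal)
    show "g ` A \<subseteq> ?R"
    proof clarify
      fix j assume "j \<in> A"
      have "(\<Sum>i\<in>A. scale (if i = j then 1 else 0) (g i)) = (\<Sum>i\<in>A. if i
          = j then g j else 0)"
        by (rule sum.cong) auto
      also have "\<dots> = g j" using \<open>j \<in> A\<close> assms(1) by simp
      finally have eq: "(\<Sum>i\<in>A. scale (if i = j then 1 else 0) (g i)) = g j" .
      show "g j \<in> ?R" by (rule range_eqI[where x = "\<lambda>i. if i
          = j then 1 else 0"]) (simp only: eq)
    qed
    show "subspace ?R"
      unfolding subspace_def
    proof (intro conjI ballI allI)
      show "0 \<in> ?R" by (rule range_eqI[where x = "\<lambda>_. 0"]) simp
      show "x + y \<in> ?R" if "x \<in> ?R" "y \<in> ?R" for x y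
      proof -
        from that obtain u v where "x = (\<Sum>i\<in>A. scale (u i) (g i))" "y
            = (\<Sum>i\<in>A. scale (v i) (g i))"
          by blast
        then have "x + y = (\<Sum>i\<in>A. scale (u i + v i) (g i))"
          by (simp only: scale_left_distrib sum.distrib)
        then show ?thesis by (rule range_eqI[where x = "\<lambda>i. u i + v i"])
      qed
      show "scale c x \<in> ?R" if x: "x \<in> ?R" for c x
      proof -
        from x obtain u where "x = (\<Sum>i\<in>A. scale (u i) (g i))" by blast
        then have "scale c x = (\<Sum>i\<in>A. scale (c * u i) (g i))"
          by (simp only: scale_sum_right scale_scale)
        then show ?thesis by (rule range_eqI[where x = "\<lambda>i. c * u i"])
      qed
    qed
  qed
  then show thesis using assms(2) that by blast
qed

end

section \<open>Graded modules and minimal covers\<close>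

lemma lookup_map_times:
  "Poly_Mapping.lookup (Poly_Mapping.map ((*) (q :: 'r::comm_ring_1)) f) e
      = q * Poly_Mapping.lookup f e"
  by (auto simp: Poly_Mapping.map.rep_eq when_def)

lemma free_module_zero: "0 \<in> free_module b"
  by (simp add: free_module_def)

lemma free_module_add: "f \<in> free_module b \<Longrightarrow> g \<in> free_module b
    \<Longrightarrow> f + g \<in> free_module b"
  using keys_add[of f g] by (auto simp: free_module_def)

lemma free_module_map_times:
  "f \<in> free_module b \<Longrightarrow> Poly_Mapping.map ((*) (q :: 'r::comm_ring_1)) f
      \<in> free_module b"
  unfolding free_module_def mem_Collect_eq
  by (metis in_keys_iff lookup_map_times mult_zero_right subset_iff)

lemma free_module_single: "e \<in> basis b \<Longrightarrow> Poly_Mapping.single e q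
    \<in> free_module b"
  by (simp add: free_module_def)

lemma irrelevant_ideal_mult:
  assumes "p \<in> irrelevant_ideal"
  shows "q * p \<in> (irrelevant_ideal :: ('x::finite, 'k::comm_ring_1) mpoly set)"
proof -
  have "hpart 0 (q * p) = (\<Sum>m\<in>Poly_Mapping.keys p. hpart 0 (q * Poly_Mapping.single m
      (Poly_Mapping.lookup p m)))"
    by (subst (1) poly_mapping_sum_single[of p]) (simp add: sum_distrib_left hpart_sum)
  also have "\<dots> = 0"
  proof (rule sum.neutral, rule ballI)
    fix m assume "m \<in> Poly_Mapping.keys p"
    then have "m \<noteq> 0" using assms by (auto simp: irrelevant_ideal_def in_keys_iff)
    then show "hpart 0 (q * Poly_Mapping.single m (Poly_Mapping.lookup p m)) = 0"
      by (subst hpart_mult[where e = "mdeg m"]) (auto simp: hpart_single)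
  qed
  finally have "Poly_Mapping.lookup (hpart 0 (q * p)) 0 = 0" by simp
  then show ?thesis by (simp add: lookup_hpart irrelevant_ideal_def)
qed

lemma var_irrelevant: "var x \<in> irrelevant_ideal"
proof -
  have "Poly_Mapping.single x (1 :: nat) \<noteq> 0" by (metis mdeg_single mdeg_zero zero_neq_one)
  then show ?thesis by (simp add: irrelevant_ideal_def lookup_single)
qed

lemma irrelevant_ideal_add:
  "p \<in> irrelevant_ideal \<Longrightarrow> q \<in> irrelevant_ideal \<Longrightarrow> p + q
      \<in> irrelevant_ideal"
  by (simp add: irrelevant_ideal_def lookup_add)

lemma irrelevant_ideal_zero: "0 \<in> irrelevant_ideal"
  by (simp add: irrelevant_ideal_def)

text \<open>Instantiated by the ring, for the cover of I, and by all finitely supported vectors, for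
  the covers of the later kernels. Each \<open>free_module b\<close> is then merely a subset of one
  type.\<close>

locale graded_module = module scale
  for scale :: "('x::finite, 'k::field) mpoly \<Rightarrow> 'm::ab_group_add \<Rightarrow> 'm" +
  fixes part :: "nat \<Rightarrow> 'm \<Rightarrow> 'm"
  assumes part_add: "part d (f + g) = part d f + part d g"
    and part_part: "part d (part e f) = (if d = e then part d f else 0)"
    and sum_part: "\<exists>N. f = (\<Sum>d<N. part d f)"
    and part_scale: "part e f = f \<Longrightarrow>
      part j (scale q f) = (if e \<le> j then scale (hpart (j - e) q) f else 0)"
begin

abbreviation kscale :: "'k \<Rightarrow> 'm \<Rightarrow> 'm" where
  "kscale c \<equiv> scale (Poly_Mapping.single 0 c)"

sublocale vs: vector_space kscale
  by unfold_locales
    (simp_all add: scale_right_distrib scale_left_distrib single_add mult_single)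

sublocale part: additive "part d"
  by unfold_locales (rule part_add)

lemma part_kscale: "part e f = f \<Longrightarrow> part e (kscale c f) = kscale c f"
  by (simp add: part_scale hpart_0)

definition graded_submodule :: "'m set \<Rightarrow> bool" where
  "graded_submodule M \<longleftrightarrow> subspace M \<and>
      (\<forall>f\<in>M. \<forall>d. part d f \<in> M)"

definition graded_piece :: "'m set \<Rightarrow> nat \<Rightarrow> 'm set" where
  "graded_piece M d = {f \<in> M. part d f = f}"

text \<open>For graded \<open>M\<close> this is degree \<open>d\<close> of m M, where m is the
  irrelevant ideal. Single variables and the preceding degree suffice, because every monomial of
  positive degree splits off a variable; in degree 0 the span is trivial.\<close>

definition decomposables :: "'m set \<Rightarrow> nat \<Rightarrow> 'm set" where
  "decomposables M d = vs.span {scale (var x) f | x f e. d = Suc e \<and> f \<in> graded_piece M e}"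

definition extend :: "(nat \<times> nat \<Rightarrow> 'm) \<Rightarrow>
    (nat \<times> nat \<Rightarrow>\<^sub>0 ('x, 'k) mpoly) \<Rightarrow> 'm" where
  "extend \<delta> f = (\<Sum>e\<in>Poly_Mapping.keys f. scale (Poly_Mapping.lookup f e) (\<delta> e))"

text \<open>Minimality is put as a condition on the kernel: it lies in m F. This is what a minimal
  resolution asks of the next map, so covers of successive kernels fit together.\<close>

definition minimal_cover :: "'m set \<Rightarrow> (nat \<Rightarrow> nat) \<Rightarrow>
    (nat \<times> nat \<Rightarrow> 'm) \<Rightarrow> bool" where
  "minimal_cover M b \<delta> \<longleftrightarrow>
     (\<forall>e\<in>basis b. part (fst e) (\<delta> e) = \<delta> e) \<and>
     extend \<delta> ` free_module b = M \<and>
     (\<forall>f\<in>free_module b. extend \<delta> f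
         = 0 \<longrightarrow> (\<forall>e. Poly_Mapping.lookup f e \<in> irrelevant_ideal))"

section \<open>Graded pieces, decomposable elements and minimal covers\<close>

lemma graded_submoduleD:
  assumes "graded_submodule M"
  shows "subspace M" and "f \<in> M \<Longrightarrow> part d f \<in> M"
  using assms by (auto simp: graded_submodule_def)

lemma subspace_vs: "subspace M \<Longrightarrow> vs.subspace M"
  by (auto simp: subspace_def vs.subspace_def)

lemma subspace_graded_piece: "subspace M \<Longrightarrow> vs.subspace (graded_piece M d)"
  by (auto simp: subspace_def vs.subspace_def graded_piece_def part.add part.zero part_kscale)

lemma scale_graded_piece:
  assumes "subspace M" "f \<in> graded_piece M d" "hpart k q = q"
  shows "scale q f \<in> graded_piece M (d + k)"
  using assms by (auto simp: graded_piece_def part_scale subspace_scale)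

lemma decomposables_subset_graded_piece:
  assumes "subspace M"
  shows "decomposables M d \<subseteq> graded_piece M d"
  unfolding decomposables_def
proof (rule vs.span_minimal[OF _ subspace_graded_piece[OF assms]], clarify)
  fix x f e assume "d = Suc e" "f \<in> graded_piece M e"
  then show "scale (var x) f \<in> graded_piece M (Suc e)"
    using scale_graded_piece[OF assms, of f e 1 "var x"] by (simp add: hpart_single)
qed

lemma scale_in_decomposables:
  assumes M: "subspace M" and f: "f \<in> graded_piece M e" and q: "hpart k q = q" and "k > 0"
  shows "scale q f \<in> decomposables M (e + k)"
proof -
  obtain k' where k': "k = Suc k'" using \<open>k > 0\<close> by (cases k) auto
  have "scale (Poly_Mapping.single m (Poly_Mapping.lookup q m)) f \<in> decomposables M (e + k)"
    if m: "m \<in> Poly_Mapping.keys q" for m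
  proof -
    have "mdeg m = Suc k'" using hpart_eq_self_keys[OF q m] k' by simp
    then obtain x m' where x: "m = Poly_Mapping.single x 1 + m'" "mdeg m' = k'"
      by (rule monomial_decompose)
    let ?r = "Poly_Mapping.single m' (Poly_Mapping.lookup q m)"
    have "scale ?r f \<in> graded_piece M (e + k')"
      by (intro scale_graded_piece M f) (simp add: hpart_single x)
    moreover have "scale (Poly_Mapping.single m (Poly_Mapping.lookup q m)) f
        = scale (var x) (scale ?r f)"
      by (simp add: x(1) mult_single)
    ultimately show ?thesis
      unfolding decomposables_def k' by (intro vs.span_base) (metis
          (mono_tags, lifting) add_Suc_right mem_Collect_eq)
  qed
  then have "(\<Sum>m\<in>Poly_Mapping.keys q. scale (Poly_Mapping.single m
      (Poly_Mapping.lookup q m)) f)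
      \<in> decomposables M (e + k)"
    unfolding decomposables_def by (intro vs.span_sum)
  then show ?thesis
    by (simp flip: scale_sum_left poly_mapping_sum_single)
qed

lemma extend_superset:
  assumes "finite A" "Poly_Mapping.keys f \<subseteq> A"
  shows "extend \<delta> f = (\<Sum>e\<in>A. scale (Poly_Mapping.lookup f e) (\<delta> e))"
  unfolding extend_def using assms by (intro sum.mono_neutral_left) (auto simp: in_keys_iff)

lemma extend_add: "extend \<delta> (f + g) = extend \<delta> f + extend \<delta> g"
proof -
  let ?A = "Poly_Mapping.keys f \<union> Poly_Mapping.keys g"
  have "Poly_Mapping.keys (f + g) \<subseteq> ?A" by (rule keys_add)
  then show ?thesis
    by (simp add: extend_superset[of ?A] lookup_add scale_left_distrib sum.distrib)
qed

sublocale extend: additive "extend \<delta>"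
  by unfold_locales (rule extend_add)

lemma extend_single: "extend \<delta> (Poly_Mapping.single e q) = scale q (\<delta> e)"
  by (simp add: extend_def)

lemma extend_map: "extend \<delta> (Poly_Mapping.map ((*) q) f) = scale q (extend \<delta> f)"
proof -
  have "extend \<delta> (Poly_Mapping.map ((*) q) f) =
      (\<Sum>e\<in>Poly_Mapping.keys f. scale (Poly_Mapping.lookup (Poly_Mapping.map ((*) q) f) e)
          (\<delta> e))"
    by (rule extend_superset) (auto simp: in_keys_iff lookup_map_times)
  then show ?thesis
    by (simp add: lookup_map_times scale_sum_right extend_def)
qed

lemma extend_mem:
  assumes "subspace M" "\<forall>e\<in>basis b. \<delta> e \<in> M" "f \<in> free_module b"
  shows "extend \<delta> f \<in> M"
  unfolding extend_def
  using assms by (intro subspace_sum subspace_scale) (auto simp: free_module_def)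

text \<open>Modulo \<open>decomposables\<close>, only the constant terms of the coordinates in
  degree \<open>j\<close> contribute.\<close>

lemma part_extend_mod_decomposables:
  assumes M: "subspace M" and \<delta>: "\<forall>e\<in>basis b. \<delta> e
      \<in> graded_piece M (fst e)"
    and f: "f \<in> free_module b"
  shows "part j (extend \<delta> f) -
      (\<Sum>r<b j. kscale (Poly_Mapping.lookup (Poly_Mapping.lookup f (j, r)) 0) (\<delta> (j, r)))
      \<in> decomposables M j"
proof -
  let ?K = "Poly_Mapping.keys f"
  let ?t = "\<lambda>e. if fst e \<le> j then scale (hpart (j - fst e) (Poly_Mapping.lookup f e))
      (\<delta> e) else 0"
  let ?c = "\<lambda>e. kscale (Poly_Mapping.lookup (Poly_Mapping.lookup f e) 0) (\<delta> e)"
  have K: "?K \<subseteq> basis b" using f by (simp add: free_module_def)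
  have "part j (extend \<delta> f) = (\<Sum>e\<in>?K. ?t e)"
    unfolding extend_def part.sum using K \<delta>
    by (intro sum.cong refl part_scale) (auto simp: graded_piece_def)
  also have "\<dots> = (\<Sum>e\<in>{e\<in>?K. fst e
      = j}. ?t e) + (\<Sum>e\<in>{e\<in>?K. fst e \<noteq> j}. ?t e)"
    by (subst sum.union_disjoint[symmetric]) (auto intro: sum.cong)
  also have "(\<Sum>e\<in>{e\<in>?K. fst e = j}. ?t e) = (\<Sum>e\<in>{e\<in>?K. fst e = j}. ?c e)"
    by (rule sum.cong) (auto simp: hpart_0)
  also have "\<dots> = (\<Sum>e\<in>Pair j ` {..<b j}. ?c e)"
    using K by (intro sum.mono_neutral_left) (auto simp: basis_def in_keys_iff)
  also have "\<dots> = (\<Sum>r<b j. ?c (j, r))"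
    by (subst sum.reindex) (auto simp: inj_on_def)
  finally have "part j (extend \<delta> f) - (\<Sum>r<b j. ?c (j, r))
      = (\<Sum>e\<in>{e\<in>?K. fst e \<noteq> j}. ?t e)"
    by simp
  also have "\<dots> \<in> decomposables M j"
  proof (unfold decomposables_def, rule vs.span_sum, fold decomposables_def)
    fix e assume e: "e \<in> {e\<in>?K. fst e \<noteq> j}"
    show "?t e \<in> decomposables M j"
    proof (cases "fst e < j")
      case True
      have "scale (hpart (j - fst e) (Poly_Mapping.lookup f e)) (\<delta> e)
          \<in> decomposables M (fst e + (j - fst e))"
        using M True e K \<delta> by (intro scale_in_decomposables) (auto simp: hpart_hpart)
      then show ?thesis using True by simp
    next
      case False
      then show ?thesis using e by (simp add: decomposables_def vs.span_zero)
    qed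
  qed
  finally show ?thesis .
qed

text \<open>The elements of \<open>E d - D d\<close> generate by strong induction on the degree, as
  decomposables come from the preceding degree. If a coefficient of a relation had a nonzero
  constant term, then in its degree j a nontrivial combination of \<open>E j - D j\<close> would lie
  in the span of \<open>D j\<close>, against the independence of \<open>E j\<close>.\<close>

lemma minimal_cover_exists:
  assumes M: "graded_submodule M"
    and fin: "\<And>d. \<exists>T. finite T \<and> graded_piece M d \<subseteq> vs.span T"
  shows "\<exists>b \<delta>. minimal_cover M b \<delta>"
proof -
  have sM: "subspace M" using M by (rule graded_submoduleD)
  have "\<exists>D E. D \<subseteq> E \<and> vs.independent E \<and> finite E \<and> vs.span D
      = decomposables M d \<and>
      vs.span E = graded_piece M d" for d
  proof -
    obtain T where T: "finite T" "graded_piece M d \<subseteq> vs.span T" using fin by blast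
    obtain D where D: "D \<subseteq> decomposables M d" "vs.independent D" "decomposables M d
        \<subseteq> vs.span D"
      by (rule vs.maximal_independent_subset)
    then have "D \<subseteq> graded_piece M d"
      using decomposables_subset_graded_piece[OF sM] by blast
    then obtain E where E: "D \<subseteq> E" "E \<subseteq> graded_piece M d" "vs.independent E"
      "graded_piece M d \<subseteq> vs.span E"
      by (rule vs.maximal_independent_subset_extend[OF _ D(2)])
    have "finite E"
      using vs.independent_span_bound[OF T(1) E(3)] E(2) T(2) by blast
    moreover have "vs.span E = graded_piece M d"
      using E by (intro antisym vs.span_minimal subspace_graded_piece sM)
    moreover have "vs.span D = decomposables M d"
      using D by (intro antisym) (auto simp: decomposables_def vs.span_minimal)
    ultimately show ?thesis using E by blast
  qed
  then obtain D E where DE: "\<And>d. D d \<subseteq> E d" "\<And>d. vs.independent (E d)"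
      "\<And>d. finite (E d)"
    "\<And>d. vs.span (D d) = decomposables M d" "\<And>d. vs.span (E d) = graded_piece M d"
    by metis
  define b where "b d = card (E d - D d)" for d
  have "\<exists>g. bij_betw g {..<b d} (E d - D d)" for d
    using ex_bij_betw_nat_finite[of "E d - D d"] DE(3) by (auto simp: b_def atLeast0LessThan)
  then obtain g where g: "\<And>d. bij_betw (g d) {..<b d} (E d - D d)" by metis
  define \<delta> where "\<delta> e = g (fst e) (snd e)" for e
  have \<delta>_pair: "\<delta> (j, r) = g j r" for j r by (simp add: \<delta>_def)
  have \<delta>E: "\<delta> e \<in> E (fst e) - D (fst e)" if "e \<in> basis b" for e
    using that g[of "fst e"] by (auto simp: \<delta>_def basis_def bij_betw_def)
  have \<delta>: "\<forall>e\<in>basis b. \<delta> e \<in> graded_piece M (fst e)"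
    using \<delta>E DE(5) vs.span_base by blast
  have image: "subspace (extend \<delta> ` free_module b)"
    unfolding subspace_def
  proof (intro conjI ballI allI)
    show "0 \<in> extend \<delta> ` free_module b" using free_module_zero extend.zero by force
    show "x + y \<in> extend \<delta> ` free_module b"
      if "x \<in> extend \<delta> ` free_module b" "y \<in> extend \<delta> ` free_module b" for x y
      using that by (auto simp: free_module_add simp flip: extend_add)
    show "scale q x \<in> extend \<delta> ` free_module b" if "x
        \<in> extend \<delta> ` free_module b" for q x
      using that by (auto simp: free_module_map_times simp flip: extend_map)
  qed
  have piece: "graded_piece M d \<subseteq> extend \<delta> ` free_module b" for d
  proof (induction d rule: less_induct)
    case (less d)
    have "D d \<subseteq> extend \<delta> ` free_module b"
    proof -
      have "decomposables M d \<subseteq> extend \<delta> ` free_module b"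
        unfolding decomposables_def using less.IH
        by (intro vs.span_minimal subspace_vs image) (auto intro!: subspace_scale[OF image])
      then show ?thesis using DE(4) vs.span_superset by blast
    qed
    moreover have "E d - D d \<subseteq> extend \<delta> ` free_module b"
    proof
      fix a assume "a \<in> E d - D d"
      then obtain r where r: "r < b d" "a = \<delta> (d, r)"
        using g[of d] by (auto simp: bij_betw_def \<delta>_def)
      show "a \<in> extend \<delta> ` free_module b"
        by (rule image_eqI[where x = "Poly_Mapping.single (d, r) 1"])
          (use r in \<open>auto simp: extend_single free_module_def basis_def\<close>)
    qed
    ultimately have "E d \<subseteq> extend \<delta> ` free_module b" by blast
    then show ?case
      using vs.span_minimal[OF _ subspace_vs[OF image]] DE(5) by blast
  qed
  have "minimal_cover M b \<delta>"
    unfolding minimal_cover_def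
  proof (intro conjI ballI impI allI)
    show "part (fst e) (\<delta> e) = \<delta> e" if "e \<in> basis b" for e
      using that \<delta> by (auto simp: graded_piece_def)
    show "extend \<delta> ` free_module b = M"
    proof
      show "extend \<delta> ` free_module b \<subseteq> M"
        using extend_mem[OF sM, of b \<delta>] \<delta> by (auto simp: graded_piece_def)
      show "M \<subseteq> extend \<delta> ` free_module b"
      proof
        fix f assume f: "f \<in> M"
        obtain N where "f = (\<Sum>d<N. part d f)" using sum_part by blast
        moreover have "part d f \<in> extend \<delta> ` free_module b" for d
          using piece[of d] graded_submoduleD(2)[OF M f, of d]
          by (auto simp: graded_piece_def part_part)
        ultimately show "f \<in> extend \<delta> ` free_module b"
          using subspace_sum[OF image] by metis
      qed
    qed
    fix f :: "nat \<times> nat \<Rightarrow>\<^sub>0 ('x, 'k) mpoly" and e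
    assume f: "f \<in> free_module b" and z: "extend \<delta> f = 0"
    show "Poly_Mapping.lookup f e \<in> irrelevant_ideal"
    proof (cases "e \<in> basis b")
      case True
      obtain j r where e: "e = (j, r)" "r < b j" using True by (auto simp: basis_def)
      let ?u = "\<lambda>r. Poly_Mapping.lookup (Poly_Mapping.lookup f (j, r)) 0"
      have "- (\<Sum>r<b j. kscale (?u r) (g j r)) \<in> vs.span (D j)"
        using part_extend_mod_decomposables[OF sM \<delta> f, of j] z
        by (simp add: part.zero DE(4) \<delta>_pair)
      then have "(\<Sum>r<b j. kscale (?u r) (g j r)) \<in> vs.span (D j)"
        using vs.span_neg by fastforce
      then have "?u r = 0"
        using g[of j] DE e(2)
        by (intro vs.independent_family_imp_coeff_zero[of "E j" "{..<b j}" "g j" "D j"])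
          (auto simp: bij_betw_def)
      then show ?thesis using e by (simp add: irrelevant_ideal_def)
    next
      case False
      then have "Poly_Mapping.lookup f e = 0"
        using f by (auto simp: free_module_def in_keys_iff)
      then show ?thesis by (simp add: irrelevant_ideal_def)
    qed
  qed
  then show ?thesis by blast
qed

lemma minimal_cover_generator:
  assumes "minimal_cover M b \<delta>" "e \<in> basis b"
  shows "\<delta> e \<in> graded_piece M (fst e)"
proof -
  have "extend \<delta> (Poly_Mapping.single e 1) \<in> M"
    using assms free_module_single[of e b 1] by (auto simp: minimal_cover_def)
  then show ?thesis
    using assms by (simp add: extend_single graded_piece_def minimal_cover_def)
qed

text \<open>Graded Nakayama. The generators of degree \<open>j\<close> span the piece modulo
  decomposables. They are independent modulo decomposables: a decomposable combination is also the
  image of a vector \<open>h\<close> with coordinates in the irrelevant ideal, and the difference of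
  the two preimages is a relation whose constant terms are the coefficients
  \<open>u r\<close>.\<close>

lemma minimal_cover_dim:
  assumes M: "graded_submodule M" and cover: "minimal_cover M b \<delta>"
    and fin: "finite T" "graded_piece M j \<subseteq> vs.span T"
  shows "vs.dim (graded_piece M j) = vs.dim (decomposables M j) + b j"
proof -
  have sM: "subspace M" using M by (rule graded_submoduleD)
  have image: "extend \<delta> ` free_module b = M"
    and min: "\<And>f e. f \<in> free_module b \<Longrightarrow> extend \<delta> f = 0
        \<Longrightarrow> Poly_Mapping.lookup f e \<in> irrelevant_ideal"
    using cover by (auto simp: minimal_cover_def)
  have \<delta>: "\<forall>e\<in>basis b. \<delta> e \<in> graded_piece M (fst e)"
    using minimal_cover_generator[OF cover] by blast
  obtain D where D: "D \<subseteq> decomposables M j" "vs.independent D" "decomposables M j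
      \<subseteq> vs.span D"
    by (rule vs.maximal_independent_subset)
  have spanD: "vs.span D = decomposables M j"
    using D by (intro antisym) (auto simp: decomposables_def vs.span_minimal)
  have DM: "D \<subseteq> graded_piece M j"
    using D decomposables_subset_graded_piece[OF sM] by blast
  have finD: "finite D"
    using vs.independent_span_bound[OF fin(1) D(2)] DM fin(2) by blast
  let ?g = "\<lambda>r. \<delta> (j, r)"
  let ?Fm = "{f \<in> free_module b. \<forall>e. Poly_Mapping.lookup f e \<in> irrelevant_ideal}"
  \<comment> \<open>If \<open>h\<close> maps to f, then x h maps to x f and has all coordinates in
    the irrelevant ideal.\<close>
  have decomp: "decomposables M j \<subseteq> extend \<delta> ` ?Fm"
    unfolding decomposables_def
  proof (rule vs.span_minimal)
    show "{scale (var x) f | x f e. j = Suc e \<and> f \<in> graded_piece M e}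
        \<subseteq> extend \<delta> ` ?Fm"
    proof clarify
      fix x f e assume "f \<in> graded_piece M e"
      then obtain h where h: "h \<in> free_module b" "f = extend \<delta> h"
        using image by (auto simp: graded_piece_def)
      have "var x * p \<in> irrelevant_ideal" for p :: "('x, 'k) mpoly"
        using irrelevant_ideal_mult[OF var_irrelevant, of p x] by (simp add: mult.commute)
      then show "scale (var x) f \<in> extend \<delta> ` ?Fm"
        by (intro image_eqI[where x = "Poly_Mapping.map ((*) (var x)) h"])
          (use h in \<open>auto simp: extend_map free_module_map_times lookup_map_times\<close>)
    qed
    show "vs.subspace (extend \<delta> ` ?Fm)"
      unfolding vs.subspace_def
    proof (intro conjI ballI allI)
      show "0 \<in> extend \<delta> ` ?Fm"
        by (rule image_eqI[where x = 0])
          (auto simp: extend.zero free_module_zero irrelevant_ideal_zero)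
      fix u v assume "u \<in> extend \<delta> ` ?Fm" "v \<in> extend \<delta> ` ?Fm"
      then obtain f h where fh: "f \<in> ?Fm" "h \<in> ?Fm" "u = extend \<delta> f" "v
          = extend \<delta> h" by blast
      show "u + v \<in> extend \<delta> ` ?Fm"
        by (rule image_eqI[where x = "f + h"])
          (use fh in \<open>auto simp: extend_add free_module_add irrelevant_ideal_add
              lookup_add\<close>)
    next
      fix c u assume "u \<in> extend \<delta> ` ?Fm"
      then obtain f where f: "f \<in> ?Fm" "u = extend \<delta> f" by blast
      show "kscale c u \<in> extend \<delta> ` ?Fm"
        by (rule image_eqI[where x = "Poly_Mapping.map ((*) (Poly_Mapping.single 0 c)) f"])
          (use f in \<open>auto simp: extend_map free_module_map_times irrelevant_ideal_mult
              lookup_map_times\<close>)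
    qed
  qed
  have coeff: "\<forall>r\<in>{..<b j}. u r = 0" if u: "(\<Sum>r<b j. kscale (u r) (?g r))
      \<in> vs.span D" for u
  proof
    fix r assume r: "r \<in> {..<b j}"
    obtain h where h: "h \<in> ?Fm" "(\<Sum>r<b j. kscale (u r) (?g r)) = extend \<delta> h"
      using u decomp spanD by blast
    define f where "f = (\<Sum>r<b j. Poly_Mapping.single (j, r) (Poly_Mapping.single 0 (u r) ::
        ('x, 'k) mpoly))"
    have lookup_f: "Poly_Mapping.lookup f e =
        (if fst e = j \<and> snd e < b j then Poly_Mapping.single 0 (u (snd e)) else 0)" for e
      by (cases e) (auto simp: f_def lookup_sum lookup_single when_def)
    have f: "f \<in> free_module b"
      by (auto simp: free_module_def in_keys_iff lookup_f basis_def split: if_splits)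
    have "extend \<delta> f = (\<Sum>r<b j. kscale (u r) (?g r))"
      by (simp add: f_def extend.sum extend_single)
    then have "extend \<delta> (f - h) = 0" using h by (simp add: extend.diff)
    moreover have "f - h \<in> free_module b"
      using f h keys_diff[of f h] by (auto simp: free_module_def)
    ultimately have "Poly_Mapping.lookup (f - h) (j, r) \<in> irrelevant_ideal"
      using min by blast
    then show "u r = 0"
      using h r by (auto simp: irrelevant_ideal_def lookup_minus lookup_f)
  qed
  have *: "inj_on ?g {..<b j} \<and> ?g ` {..<b j} \<inter> D
      = {} \<and> vs.independent (D \<union> ?g ` {..<b j})"
    by (rule vs.independent_Un_family[OF D(2) finD _ coeff]) auto
  have "graded_piece M j \<subseteq> vs.span (D \<union> ?g ` {..<b j})"
  proof
    fix f assume f: "f \<in> graded_piece M j"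
    then obtain h where h: "h \<in> free_module b" "f = extend \<delta> h"
      using image by (auto simp: graded_piece_def)
    let ?s = "\<Sum>r<b j. kscale (Poly_Mapping.lookup (Poly_Mapping.lookup h (j, r)) 0) (?g r)"
    have "f - ?s \<in> vs.span D"
      using part_extend_mod_decomposables[OF sM \<delta> h(1), of j] f h(2) spanD
      by (simp add: graded_piece_def)
    then have "f - ?s \<in> vs.span (D \<union> ?g ` {..<b j})"
      using vs.span_mono[of D] by blast
    moreover have "?s \<in> vs.span (D \<union> ?g ` {..<b j})"
      by (intro vs.span_sum vs.span_scale vs.span_base) auto
    ultimately show "f \<in> vs.span (D \<union> ?g ` {..<b j})"
      using vs.span_add by fastforce
  qed
  moreover have "D \<union> ?g ` {..<b j} \<subseteq> graded_piece M j"
    using DM \<delta> by (auto simp: basis_def)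
  ultimately have "vs.dim (graded_piece M j) = card (D \<union> ?g ` {..<b j})"
    using * vs.basis_card_eq_dim by metis
  also have "\<dots> = card D + b j"
    using * finD by (subst card_Un_disjoint) (auto simp: card_image)
  also have "card D = vs.dim (decomposables M j)"
    using D vs.basis_card_eq_dim by metis
  finally show ?thesis .
qed

end

section \<open>Minimal graded free resolutions\<close>

text \<open>Coordinate \<open>e\<close> lives in R(-fst e), so degree \<open>d\<close> of the vector
  is degree \<open>d - fst e\<close> there. The case distinction prevents truncated subtraction from
  reading degree 0 when \<open>d < fst e\<close>.\<close>

definition vpart ::
    "nat \<Rightarrow> (nat \<times> nat \<Rightarrow>\<^sub>0
        ('x::finite, 'k::zero) mpoly) \<Rightarrow> nat \<times> nat \<Rightarrow>\<^sub>0
            ('x, 'k) mpoly" where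
  "vpart d f = Poly_Mapping.mapp (\<lambda>e p. if fst e \<le> d then hpart (d - fst e) p else 0) f"

lemma lookup_vpart: "Poly_Mapping.lookup (vpart d f) e =
    (if fst e \<le> d then hpart (d - fst e) (Poly_Mapping.lookup f e) else 0)"
  by (simp add: vpart_def lookup_mapp when_def in_keys_iff)

lemma keys_vpart_subset: "Poly_Mapping.keys (vpart d f) \<subseteq> Poly_Mapping.keys f"
  unfolding vpart_def by (rule keys_mapp_subset)

lemma homogeneous_vector_iff_vpart: "homogeneous_vector d f \<longleftrightarrow> vpart d f = f"
proof
  assume f: "homogeneous_vector d f"
  show "vpart d f = f"
  proof (rule poly_mapping_eqI)
    fix e
    show "Poly_Mapping.lookup (vpart d f) e = Poly_Mapping.lookup f e"
      using f by (cases "e \<in> Poly_Mapping.keys f")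
        (simp_all add: homogeneous_vector_def lookup_vpart homogeneous_iff_hpart in_keys_iff)
  qed
next
  assume *: "vpart d f = f"
  show "homogeneous_vector d f"
    unfolding homogeneous_vector_def homogeneous_iff_hpart
  proof
    fix e assume e: "e \<in> Poly_Mapping.keys f"
    have "Poly_Mapping.lookup f e = (if fst e \<le> d then hpart (d - fst e)
        (Poly_Mapping.lookup f e) else 0)"
      using lookup_vpart[of d f e] * by simp
    then show "fst e \<le> d \<and> hpart (d - fst e) (Poly_Mapping.lookup f e)
        = Poly_Mapping.lookup f e"
      using e by (auto simp: in_keys_iff split: if_splits)
  qed
qed

interpretation rg: graded_module "(*) :: ('x::finite, 'k::field) mpoly \<Rightarrow> _" hpart
proof unfold_locales
  fix d e j and f q :: "('x, 'k) mpoly"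
  show "\<exists>N. f = (\<Sum>d<N. hpart d f)" by (rule sum_hpart)
  show "hpart j (q * f) = (if e \<le> j then hpart (j - e) q * f else 0)" if "hpart e f = f"
    using that by (rule hpart_mult)
qed (simp_all add: algebra_simps hpart_add hpart_hpart)

lemma sum_vpart: "\<exists>N. f = (\<Sum>d<N. vpart d (f :: nat \<times> nat \<Rightarrow>\<^sub>0
    ('x::finite, 'k::comm_monoid_add) mpoly))"
proof -
  have "\<exists>N. \<forall>m\<in>Poly_Mapping.keys (Poly_Mapping.lookup f e). fst e + mdeg m < N"
      for e
    using finite_nat_set_iff_bounded[of "(\<lambda>m. fst e + mdeg m) ` Poly_Mapping.keys
        (Poly_Mapping.lookup f e)"]
    by auto
  then obtain N where N: "\<And>e m. m \<in> Poly_Mapping.keys (Poly_Mapping.lookup f e)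
      \<Longrightarrow> fst e + mdeg m < N e"
    by metis
  obtain K where K: "\<forall>e\<in>Poly_Mapping.keys f. N e < K"
    using finite_nat_set_iff_bounded[of "N ` Poly_Mapping.keys f"] by auto
  have "Poly_Mapping.lookup (Poly_Mapping.lookup f e) m =
      Poly_Mapping.lookup (Poly_Mapping.lookup (\<Sum>d<K. vpart d f) e) m" for e m
  proof -
    have "(\<Sum>d<K. Poly_Mapping.lookup (Poly_Mapping.lookup (vpart d f) e) m) =
        (\<Sum>d<K. if d = fst e + mdeg m then Poly_Mapping.lookup (Poly_Mapping.lookup f e) m else 0)"
      by (rule sum.cong) (auto simp: lookup_vpart lookup_hpart when_def)
    also have "\<dots> = Poly_Mapping.lookup (Poly_Mapping.lookup f e) m"
    proof (cases "m \<in> Poly_Mapping.keys (Poly_Mapping.lookup f e)")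
      case True
      then have "e \<in> Poly_Mapping.keys f" by (auto simp: in_keys_iff)
      then have "fst e + mdeg m < K" using K N[OF True] by fastforce
      then show ?thesis by simp
    qed (simp add: in_keys_iff)
    finally show ?thesis by (simp add: lookup_sum)
  qed
  then show ?thesis by (blast intro: poly_mapping_eqI)
qed

interpretation fm: graded_module
  "\<lambda>q :: ('x::finite, 'k::field) mpoly. Poly_Mapping.map ((*) q) ::
      (nat \<times> nat \<Rightarrow>\<^sub>0 _) \<Rightarrow> _" vpart
proof unfold_locales
  fix d e j and f :: "nat \<times> nat \<Rightarrow>\<^sub>0 ('x, 'k) mpoly" and q :: "('x, 'k) mpoly"
  show "\<exists>N. f = (\<Sum>d<N. vpart d f)" by (rule sum_vpart)
  show "vpart d (vpart e f) = (if d = e then vpart d f else 0)"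
    by (rule poly_mapping_eqI) (auto simp: lookup_vpart hpart_hpart)
  assume f: "vpart e f = f"
  show "vpart j (Poly_Mapping.map ((*) q) f) =
      (if e \<le> j then Poly_Mapping.map ((*) (hpart (j - e) q)) f else 0)"
  proof (rule poly_mapping_eqI)
    fix i
    have i: "Poly_Mapping.lookup f i = (if fst i \<le> e then hpart (e - fst i)
        (Poly_Mapping.lookup f i) else 0)"
      using lookup_vpart[of e f i] f by simp
    show "Poly_Mapping.lookup (vpart j (Poly_Mapping.map ((*) q) f)) i =
      Poly_Mapping.lookup (if e \<le> j then Poly_Mapping.map ((*) (hpart (j - e) q)) f else 0) i"
    proof (cases "fst i \<le> e")
      case True
      then have "hpart (e - fst i) (Poly_Mapping.lookup f i) = Poly_Mapping.lookup f i"
        using i by simp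
      then show ?thesis
        using True by (auto simp: lookup_vpart lookup_map_times hpart_mult)
    next
      case False
      then have "Poly_Mapping.lookup f i = 0" using i by simp
      then show ?thesis by (simp add: lookup_vpart lookup_map_times)
    qed
  qed
next
  fix a b :: "('x, 'k) mpoly" and x y :: "nat \<times> nat \<Rightarrow>\<^sub>0 ('x, 'k) mpoly" and d
  show "Poly_Mapping.map ((*) a) (x + y) = Poly_Mapping.map ((*) a) x + Poly_Mapping.map ((*) a) y"
    by (rule poly_mapping_eqI) (simp only: lookup_map_times lookup_add distrib_left)
  show "Poly_Mapping.map ((*) (a + b)) x = Poly_Mapping.map ((*) a) x + Poly_Mapping.map ((*) b) x"
    by (rule poly_mapping_eqI) (simp only: lookup_map_times lookup_add distrib_right)
  show "Poly_Mapping.map ((*) a) (Poly_Mapping.map ((*) b) x) = Poly_Mapping.map ((*) (a * b)) x"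
    by (rule poly_mapping_eqI) (simp only: lookup_map_times mult.assoc)
  show "Poly_Mapping.map ((*) 1) x = x"
    by (rule poly_mapping_eqI) (simp only: lookup_map_times mult_1_left)
  show "vpart d (x + y) = vpart d x + vpart d y"
    by (rule poly_mapping_eqI) (simp add: lookup_vpart lookup_add hpart_add)
qed

lemma extend_to_ring_eq: "extend_to_ring g f = rg.extend g f"
  by (simp add: extend_to_ring_def rg.extend_def)

lemma extend_to_free_eq: "extend_to_free g f = fm.extend g f"
  by (simp add: extend_to_free_def fm.extend_def)

lemma ring_graded_piece_subset_span:
  "rg.graded_piece M d \<subseteq> rg.vs.span ((\<lambda>m. Poly_Mapping.single m 1) ` monomials d)"
proof
  fix p assume "p \<in> rg.graded_piece M d"
  then have "hpart d p = p" by (simp add: rg.graded_piece_def)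
  then have *: "mdeg m = d" if "m \<in> Poly_Mapping.keys p" for m
    using that by (rule hpart_eq_self_keys)
  have "(\<Sum>m\<in>Poly_Mapping.keys p. Poly_Mapping.single 0 (Poly_Mapping.lookup p m)
      * Poly_Mapping.single m 1)
      \<in> rg.vs.span ((\<lambda>m. Poly_Mapping.single m 1) ` monomials d)"
    by (intro rg.vs.span_sum rg.vs.span_scale rg.vs.span_base) (auto simp: *)
  then show "p \<in> rg.vs.span ((\<lambda>m. Poly_Mapping.single m 1) ` monomials d)"
    by (simp add: mult_single flip: poly_mapping_sum_single)
qed

text \<open>\<open>basis b\<close> may be infinite, but basis elements of degree above
  \<open>d\<close> do not occur in a vector of degree \<open>d\<close>, and each lower degree has
  finitely many. This takes the place of finite generation of the kernels.\<close>

lemma free_graded_piece_finite_dim: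
  fixes M :: "(nat \<times> nat \<Rightarrow>\<^sub>0 ('x::finite, 'k::field) mpoly) set"
  assumes "M \<subseteq> free_module b"
  shows "\<exists>T. finite T \<and> fm.graded_piece M d \<subseteq> fm.vs.span T"
proof -
  let ?E = "Sigma {..d} (\<lambda>j. {..<b j})"
  define T where "T = (\<lambda>(e, m). Poly_Mapping.single e
      (Poly_Mapping.single m 1) :: nat \<times> nat \<Rightarrow>\<^sub>0 ('x, 'k) mpoly) `
      Sigma ?E (\<lambda>e. monomials (d - fst e))"
  have "finite T" unfolding T_def
    by (intro finite_imageI finite_SigmaI finite_monomials) auto
  moreover have "fm.graded_piece M d \<subseteq> fm.vs.span T"
  proof
    fix f assume f: "f \<in> fm.graded_piece M d"
    then have fE: "Poly_Mapping.keys f \<subseteq> basis b" and "homogeneous_vector d f"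
      using assms by (auto simp: fm.graded_piece_def free_module_def homogeneous_vector_iff_vpart)
    then have E: "e \<in> ?E" "hpart (d - fst e) (Poly_Mapping.lookup f e) = Poly_Mapping.lookup f e"
      if e: "e \<in> Poly_Mapping.keys f" for e
    proof -
      have "fst e \<le> d" "e \<in> basis b"
        and *: "hpart (d - fst e) (Poly_Mapping.lookup f e) = Poly_Mapping.lookup f e"
        using fE \<open>homogeneous_vector d f\<close> e
        by (auto simp: homogeneous_vector_def homogeneous_iff_hpart)
      then show "e \<in> ?E" by (cases e) (simp add: basis_def)
      show "hpart (d - fst e) (Poly_Mapping.lookup f e) = Poly_Mapping.lookup f e" by (rule *)
    qed
    have "Poly_Mapping.single e (Poly_Mapping.lookup f e) \<in> fm.vs.span T"
      if e: "e \<in> Poly_Mapping.keys f" for e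
    proof -
      let ?p = "Poly_Mapping.lookup f e"
      have "Poly_Mapping.single e ?p = (\<Sum>m\<in>Poly_Mapping.keys ?p.
          Poly_Mapping.map ((*) (Poly_Mapping.single 0 (Poly_Mapping.lookup ?p m)))
            (Poly_Mapping.single e (Poly_Mapping.single m 1)))"
      proof (rule poly_mapping_eqI)
        fix i
        show "Poly_Mapping.lookup (Poly_Mapping.single e ?p) i
            = Poly_Mapping.lookup (\<Sum>m\<in>Poly_Mapping.keys ?p.
          Poly_Mapping.map ((*) (Poly_Mapping.single 0 (Poly_Mapping.lookup ?p m)))
            (Poly_Mapping.single e (Poly_Mapping.single m 1))) i"
          by (cases "i = e") (simp_all add: lookup_sum mult_single lookup_map_times lookup_single
              flip: poly_mapping_sum_single)
      qed
      moreover have "Poly_Mapping.single e (Poly_Mapping.single m 1) \<in> T"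
        if "m \<in> Poly_Mapping.keys ?p" for m
        using hpart_eq_self_keys[OF E(2)[OF e] that] E(1)[OF e]
        unfolding T_def by (intro image_eqI[where x = "(e, m)"]) auto
      ultimately show ?thesis
        by (simp only:) (intro fm.vs.span_sum fm.vs.span_scale fm.vs.span_base)
    qed
    then have "(\<Sum>e\<in>Poly_Mapping.keys f. Poly_Mapping.single e (Poly_Mapping.lookup f e))
        \<in> fm.vs.span T"
      by (rule fm.vs.span_sum)
    then show "f \<in> fm.vs.span T" by (simp flip: poly_mapping_sum_single)
  qed
  ultimately show ?thesis by blast
qed

section \<open>Graded kernels and the construction of resolutions\<close>

context graded_module
begin

lemma extend_vpart:
  assumes "f \<in> free_module b" "\<And>e. e \<in> basis b
      \<Longrightarrow> part (fst e) (\<delta> e) = \<delta> e"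
  shows "extend \<delta> (vpart d f) = part d (extend \<delta> f)"
proof -
  have "extend \<delta> (vpart d f) = (\<Sum>e\<in>Poly_Mapping.keys f. scale (Poly_Mapping.lookup
      (vpart d f) e) (\<delta> e))"
    by (rule extend_superset) (simp_all add: keys_vpart_subset)
  also have "\<dots> = (\<Sum>e\<in>Poly_Mapping.keys f. part d (scale (Poly_Mapping.lookup f e)
      (\<delta> e)))"
  proof (rule sum.cong)
    fix e assume "e \<in> Poly_Mapping.keys f"
    then have "part (fst e) (\<delta> e) = \<delta> e"
      using assms by (intro assms(2)) (auto simp: free_module_def)
    then show "scale (Poly_Mapping.lookup (vpart d f) e) (\<delta> e) =
        part d (scale (Poly_Mapping.lookup f e) (\<delta> e))"
      by (simp add: part_scale lookup_vpart)
  qed simp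
  finally show ?thesis by (simp add: extend_def part.sum)
qed

lemma kernel_graded_submodule:
  assumes "\<And>e. e \<in> basis b \<Longrightarrow> part (fst e) (\<delta> e) = \<delta> e"
  shows "fm.graded_submodule {f \<in> free_module b. extend \<delta> f = 0}"
  unfolding fm.graded_submodule_def fm.subspace_def
proof (intro conjI ballI allI)
  fix f d assume f: "f \<in> {f \<in> free_module b. extend \<delta> f = 0}"
  have "vpart d f \<in> free_module b"
    using f keys_vpart_subset[of d f] by (auto simp: free_module_def)
  then show "vpart d f \<in> {f \<in> free_module b. extend \<delta> f = 0}"
    using f extend_vpart[of f b \<delta> d] assms by (simp add: part.zero)
qed (auto simp: extend.zero extend_add extend_map free_module_zero free_module_add
    free_module_map_times)

end

lemma minimal_graded_free_resolution_exists:
  fixes I :: "('x::finite, 'k::field) mpoly set"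
  assumes I: "rg.graded_submodule I"
  shows "\<exists>\<beta> \<epsilon> \<delta>. minimal_graded_free_resolution I \<beta> \<epsilon>
      \<delta>"
proof -
  obtain b \<epsilon> where \<epsilon>: "rg.minimal_cover I b \<epsilon>"
    using rg.minimal_cover_exists[OF I] ring_graded_piece_subset_span finite_monomials
    by (metis finite_imageI)
  let ?K = "{f \<in> free_module b. rg.extend \<epsilon> f = 0}"
  \<comment> \<open>A state is a rank function together with the kernel inside that free module
    which the next module has to cover. The clause for \<open>n = 0\<close> fixes the start, since
    dependent choice returns only what \<open>P 0\<close> says. That the kernel lies in m F is the
    minimality of the next map.\<close>
  define P where "P n s \<longleftrightarrow> fm.graded_submodule (snd s) \<and> snd s
      \<subseteq> free_module (fst s) \<and>
      (\<forall>f\<in>snd s. \<forall>e. Poly_Mapping.lookup f e \<in> irrelevant_ideal) \<and> (n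
          = 0 \<longrightarrow> s = (b, ?K))"
    for n :: nat and s :: "(nat \<Rightarrow> nat) \<times> (nat \<times> nat \<Rightarrow>\<^sub>0
        ('x, 'k) mpoly) set"
  define Q where "Q s s' \<longleftrightarrow> (\<exists>\<delta>. fm.minimal_cover (snd s)
      (fst s') \<delta> \<and>
      snd s' = {f \<in> free_module (fst s'). fm.extend \<delta> f = 0})"
    for s s' :: "(nat \<Rightarrow> nat) \<times> (nat \<times> nat \<Rightarrow>\<^sub>0
        ('x, 'k) mpoly) set"
  have "\<exists>s. \<forall>n. P n (s n) \<and> Q (s n) (s (Suc n))"
  proof (rule dependent_nat_choice)
    have "P 0 (b, ?K)"
      using rg.kernel_graded_submodule[of b \<epsilon>] \<epsilon>
          by (auto simp: P_def rg.minimal_cover_def)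
    then show "\<exists>s. P 0 s" ..
  next
    fix s n assume s: "P n s"
    obtain b' \<delta> where \<delta>: "fm.minimal_cover (snd s) b' \<delta>"
      using fm.minimal_cover_exists[of "snd s"] free_graded_piece_finite_dim s unfolding P_def by blast
    let ?s' = "(b', {f \<in> free_module b'. fm.extend \<delta> f = 0})"
    have "P (Suc n) ?s'"
      using fm.kernel_graded_submodule[of b' \<delta>] \<delta>
          by (auto simp: P_def fm.minimal_cover_def)
    moreover have "Q s ?s'" using \<delta> by (auto simp: Q_def)
    ultimately show "\<exists>s'. P (Suc n) s' \<and> Q s s'" by blast
  qed
  then obtain s where s: "\<And>n. P n (s n)" "\<And>n. Q (s n) (s (Suc n))" by blast
  have "\<forall>n. Q (s n) (s (Suc n))" using s(2) ..
  then obtain \<delta> where \<delta>: "\<And>n. fm.minimal_cover (snd (s n)) (fst (s (Suc n)))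
      (\<delta> n)"
    "\<And>n. snd (s (Suc n)) = {f \<in> free_module (fst (s (Suc n))). fm.extend (\<delta> n) f = 0}"
    unfolding Q_def by (auto dest!: choice)
  have s0: "s 0 = (b, ?K)" using s(1)[of 0] by (simp add: P_def)
  have gen: "\<delta> n e \<in> snd (s n)" "vpart (fst e) (\<delta> n e) = \<delta> n e" if "e
      \<in> basis (fst (s (Suc n)))" for n e
    using fm.minimal_cover_generator[OF \<delta>(1) that] by (auto simp: fm.graded_piece_def)
  have "minimal_graded_free_resolution I (\<lambda>n. fst (s n)) \<epsilon> \<delta>"
    unfolding minimal_graded_free_resolution_def extend_to_ring_eq extend_to_free_eq
      homogeneous_iff_hpart homogeneous_vector_iff_vpart
  proof (intro conjI allI ballI)
    show "hpart (fst e) (\<epsilon> e) = \<epsilon> e" if "e \<in> basis (fst (s 0))" for e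
      using that \<epsilon> s0 by (simp add: rg.minimal_cover_def)
    show "rg.extend \<epsilon> ` free_module (fst (s 0)) = I"
      using \<epsilon> s0 by (simp add: rg.minimal_cover_def)
    show "fm.extend (\<delta> 0) ` free_module (fst (s 1)) = {f
        \<in> free_module (fst (s 0)). rg.extend \<epsilon> f = 0}"
      using \<delta>(1)[of 0] s0 by (simp add: fm.minimal_cover_def)
    show "fm.extend (\<delta> (i + 1)) ` free_module (fst (s (i + 2))) =
        {f \<in> free_module (fst (s (i + 1))). fm.extend (\<delta> i) f = 0}" for i
      using \<delta>(1)[of "Suc i"] \<delta>(2)[of i] by (simp add: fm.minimal_cover_def)
    fix i e assume "e \<in> basis (fst (s (i + 1)))"
    then have e: "e \<in> basis (fst (s (Suc i)))" by simp
    show "vpart (fst e) (\<delta> i e) = \<delta> i e" by (rule gen(2)[OF e])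
    have "snd (s i) \<subseteq> free_module (fst (s i))"
      and "\<forall>f\<in>snd (s i). \<forall>e. Poly_Mapping.lookup f e \<in> irrelevant_ideal"
      using s(1)[of i] unfolding P_def by blast+
    then show "\<delta> i e \<in> free_module (fst (s i))" "Poly_Mapping.lookup (\<delta> i e) c
        \<in> irrelevant_ideal" for c
      using gen(1)[OF e] by blast+
  qed
  then show ?thesis by blast
qed

text \<open>By exactness the kernel of \<open>\<epsilon>\<close> is the image of
  \<open>\<delta> 0\<close>, and the values of \<open>\<delta> 0\<close> on the basis have their
  coordinates in the irrelevant ideal.\<close>

lemma minimal_graded_free_resolution_cover:
  assumes "minimal_graded_free_resolution I \<beta> \<epsilon> \<delta>"
  shows "rg.minimal_cover I (\<beta> 0) \<epsilon>"
  unfolding rg.minimal_cover_def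
proof (intro conjI ballI impI allI)
  note res = assms[unfolded minimal_graded_free_resolution_def extend_to_ring_eq extend_to_free_eq
      homogeneous_iff_hpart]
  note gens = res[THEN conjunct1] and tail = res[THEN conjunct2, THEN conjunct2]
  note image = tail[THEN conjunct1] and kernel = tail[THEN conjunct2, THEN conjunct1]
    and minimal = tail[THEN conjunct2, THEN conjunct2, THEN conjunct2]
  show "hpart (fst e) (\<epsilon> e) = \<epsilon> e" if "e \<in> basis (\<beta> 0)" for e
    using gens that by (rule bspec)
  show "rg.extend \<epsilon> ` free_module (\<beta> 0) = I" by (rule image)
  fix f c assume "f \<in> free_module (\<beta> 0)" "rg.extend \<epsilon> f = 0"
  then have "f \<in> fm.extend (\<delta> 0) ` free_module (\<beta> 1)" unfolding kernel by simp
  then obtain h where h: "h \<in> free_module (\<beta> 1)" "f = fm.extend (\<delta> 0) h" by blast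
  have min: "Poly_Mapping.lookup (\<delta> 0 e) c \<in> irrelevant_ideal" if "e
      \<in> basis (\<beta> 1)" for e
    using minimal[rule_format, of e 0 c] that by simp
  have "Poly_Mapping.lookup h e * Poly_Mapping.lookup (\<delta> 0 e) c \<in> irrelevant_ideal"
    if "e \<in> Poly_Mapping.keys h" for e
    using min[of e] h that by (intro irrelevant_ideal_mult) (auto simp: free_module_def)
  then have "(\<Sum>e\<in>Poly_Mapping.keys h. Poly_Mapping.lookup h e * Poly_Mapping.lookup
      (\<delta> 0 e) c) \<in> irrelevant_ideal"
    by (simp add: irrelevant_ideal_def lookup_sum)
  then show "Poly_Mapping.lookup f c \<in> irrelevant_ideal"
    by (simp add: h fm.extend_def lookup_sum lookup_map_times)
qed

text \<open>Both dimensions depend on \<open>I\<close> alone, so all minimal resolutions share the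
  same \<open>\<beta> 0 j\<close>; this settles the definite description.\<close>

lemma graded_betti_0:
  assumes I: "rg.graded_submodule I"
  shows "rg.vs.dim (rg.graded_piece I j) = rg.vs.dim (rg.decomposables I j) + graded_betti I 0 j"
proof -
  have dim: "rg.vs.dim (rg.graded_piece I j) = rg.vs.dim (rg.decomposables I j) + \<beta> 0 j"
    if "minimal_graded_free_resolution I \<beta> \<epsilon> \<delta>" for \<beta> \<epsilon> \<delta>
    by (rule rg.minimal_cover_dim[OF I minimal_graded_free_resolution_cover[OF that] _
          ring_graded_piece_subset_span]) (simp add: finite_monomials)
  obtain \<beta> \<epsilon> \<delta> where r:
      "minimal_graded_free_resolution I \<beta> \<epsilon> \<delta>"
    using minimal_graded_free_resolution_exists[OF I] by blast
  have "graded_betti I 0 j = \<beta> 0 j"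
    unfolding graded_betti_def
  proof (rule the_equality)
    show "\<exists>\<beta>' \<epsilon> \<delta>. minimal_graded_free_resolution I \<beta>'
        \<epsilon> \<delta> \<and> \<beta>' 0 j = \<beta> 0 j" using r by blast
    show "k = \<beta> 0 j" if
        "\<exists>\<beta> \<epsilon> \<delta>. minimal_graded_free_resolution I \<beta> \<epsilon>
            \<delta> \<and> \<beta> 0 j = k" for k
      using that dim[OF r] dim by force
  qed
  then show ?thesis using dim[OF r] by simp
qed

section \<open>Evaluation and ideals of points\<close>

text \<open>The k-algebra map to k[T] that sends the variable x to \<open>w x\<close>. It covers
  points as well as parametrised lines, and k[T] is an integral domain, so a product of linear forms
  vanishes only if a factor does.\<close>

definition ev :: "('x::finite \<Rightarrow> 'k::field poly) \<Rightarrow>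
    ('x, 'k) mpoly \<Rightarrow> 'k poly" where
  "ev w f = (\<Sum>m\<in>Poly_Mapping.keys f.
     [:Poly_Mapping.lookup f m:] * (\<Prod>x\<in>UNIV. w x ^ Poly_Mapping.lookup m x))"

lemma ev_superset:
  assumes "finite A" "Poly_Mapping.keys f \<subseteq> A"
  shows "ev w f = (\<Sum>m\<in>A. [:Poly_Mapping.lookup f m:] *
      (\<Prod>x\<in>UNIV. w x ^ Poly_Mapping.lookup m x))"
  unfolding ev_def using assms by (intro sum.mono_neutral_left) (auto simp: in_keys_iff)

lemma ev_add:
  fixes w :: "'x::finite \<Rightarrow> 'k::field poly"
  shows "ev w (f + g) = ev w f + ev w g"
proof -
  let ?A = "Poly_Mapping.keys f \<union> Poly_Mapping.keys g"
  have "Poly_Mapping.keys (f + g) \<subseteq> ?A" by (rule keys_add)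
  moreover have "[:c + d:] = [:c:] + [:d:]" for c d :: 'k by simp
  ultimately show ?thesis
    by (simp only: ev_superset[of ?A] finite_UnI finite_keys Un_upper1 Un_upper2 lookup_add
        distrib_right sum.distrib)
qed

interpretation ev: additive "ev w"
  by unfold_locales (rule ev_add)

lemma ev_single: "ev w (Poly_Mapping.single m c) = [:c:] *
    (\<Prod>x\<in>UNIV. w x ^ Poly_Mapping.lookup m x)"
  by (subst ev_superset[of "{m}"]) simp_all

lemma ev_mult: "ev w (f * g) = ev w f * ev w g"
proof -
  have single: "ev w (Poly_Mapping.single m c * Poly_Mapping.single m' c') =
      ev w (Poly_Mapping.single m c) * ev w (Poly_Mapping.single m' c')" for m m' c c'
    by (simp add: mult_single ev_single lookup_add power_add prod.distrib mult_ac)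
  have "ev w (f * g) = (\<Sum>m\<in>Poly_Mapping.keys f. \<Sum>m'\<in>Poly_Mapping.keys g.
      ev w (Poly_Mapping.single m (Poly_Mapping.lookup f m) * Poly_Mapping.single m'
          (Poly_Mapping.lookup g m')))"
    by (simp only: ev.sum[symmetric] sum_product[symmetric] poly_mapping_sum_single[symmetric])
  also have "\<dots> = (\<Sum>m\<in>Poly_Mapping.keys f. ev w (Poly_Mapping.single m
      (Poly_Mapping.lookup f m))) *
      (\<Sum>m'\<in>Poly_Mapping.keys g. ev w (Poly_Mapping.single m' (Poly_Mapping.lookup g m')))"
    by (simp only: single sum_product)
  also have "\<dots> = ev w f * ev w g"
    by (simp only: ev.sum[symmetric] poly_mapping_sum_single[symmetric])
  finally show ?thesis .
qed

lemma ev_const: "ev w (Poly_Mapping.single 0 c) = [:c:]"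
  by (simp add: ev_single)

lemma ev_one: "ev w 1 = 1"
  using ev_const[of w 1] by simp

lemma ev_prod: "ev w (\<Prod>i\<in>A. f i) = (\<Prod>i\<in>A. ev w (f i))"
  by (induction A rule: infinite_finite_induct) (simp_all add: ev_one ev_mult)

section \<open>Linear forms and duality\<close>

definition dot :: "'k::field ^ 'x::finite \<Rightarrow> 'k ^ 'x \<Rightarrow> 'k" where
  "dot a p = (\<Sum>x\<in>UNIV. a $ x * p $ x)"

lemma dot_scale_left: "dot (c *s a) p = c * dot a p"
  by (simp add: dot_def sum_distrib_left mult_ac)

lemma dot_diff_left: "dot (a - b) p = dot a p - dot b p"
  by (simp add: dot_def left_diff_distrib sum_subtractf)

lemma dot_scale_right: "dot a (c *s p) = c * dot a p"
  by (simp add: dot_def sum_distrib_left mult_ac)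

lemma dot_axis: "dot (axis x c) p = c * p $ x"
proof -
  have "dot (axis x c) p = (\<Sum>y\<in>UNIV. if y = x then c * p $ x else 0)"
    unfolding dot_def by (rule sum.cong) (auto simp: axis_def)
  then show ?thesis by simp
qed

lemma ex_dot_eq_1:
  assumes "p \<noteq> 0"
  shows "\<exists>b. dot b p = 1"
proof -
  obtain x where "p $ x \<noteq> 0" using assms by (auto simp: vec_eq_iff)
  then have "dot (axis x (1 / p $ x)) p = 1" by (simp add: dot_axis)
  then show ?thesis ..
qed

text \<open>A basis of the span of \<open>U\<close>, enlarged by \<open>a\<close>, carries a
  functional that is 0 on the basis and 1 at \<open>a\<close>; \<open>w\<close> lists its values on
  the unit vectors.\<close>

lemma not_in_span_imp_dot:
  fixes U :: "('k::field ^ 'x::finite) set"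
  assumes "a \<notin> vec.span U"
  obtains w where "\<And>u. u \<in> U \<Longrightarrow> dot u w = 0" "dot a w = 1"
proof -
  interpret vp: vector_space_pair "(*s) :: 'k \<Rightarrow> 'k ^ 'x \<Rightarrow> _"
      "(*) :: 'k \<Rightarrow> _"
    by unfold_locales (simp_all add: algebra_simps)
  obtain B where B: "B \<subseteq> U" "vec.independent B" "U \<subseteq> vec.span B"
    by (rule vec.maximal_independent_subset)
  have "a \<notin> vec.span B" using assms B vec.span_mono by blast
  then have aB: "vec.independent (insert a B)" "a \<notin> B"
    using B vec.span_base by (auto simp: vec.independent_insertI)
  obtain g where g: "Vector_Spaces.linear (*s) (*) g" "\<forall>x\<in>insert a B. g x = (if x
      = a then 1 else 0)"
    using vp.linear_independent_extend[OF aB(1), of "\<lambda>x. if x = a then 1 else 0"] by blast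
  interpret g: Vector_Spaces.linear "(*s)" "(*)" g by (rule g(1))
  have g0: "g b = 0" if "b \<in> B" for b using g(2) that aB(2) by auto
  define w where "w = (\<chi> x. g (axis x 1))"
  have dot_w: "dot u w = g u" for u
  proof -
    have "g u = g (\<Sum>x\<in>UNIV. u $ x *s axis x 1)" by (simp add: basis_expansion)
    also have "\<dots> = (\<Sum>x\<in>UNIV. u $ x * g (axis x 1))" by (simp only: g.sum g.scale)
    finally show ?thesis by (simp add: dot_def w_def)
  qed
  show thesis
  proof
    show "dot u w = 0" if "u \<in> U" for u
      using that B(3) g0 vp.linear_eq_0_on_span[OF g(1), of B u] by (auto simp: dot_w)
    show "dot a w = 1" using g(2) by (simp add: dot_w)
  qed
qed

lemma linear_form_add: "linear_form (a + b) = linear_form a + linear_form b"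
  by (simp add: linear_form_def single_add sum.distrib)

lemma linear_form_zero: "linear_form 0 = 0"
  by (simp add: linear_form_def)

lemma linear_form_scale: "linear_form (c *s a) = Poly_Mapping.single 0 c * linear_form a"
  by (simp add: linear_form_def sum_distrib_left mult_single)

lemma linear_form_diff: "linear_form (a - b) = linear_form a - linear_form b"
  by (simp add: linear_form_def single_diff sum_subtractf)

lemma linear_form_axis:
  fixes x :: "'x::finite"
  shows "linear_form (axis x (1 :: 'k::field)) = var x"
proof -
  have "linear_form (axis x (1 :: 'k)) =
      (\<Sum>y\<in>UNIV. if y = x then Poly_Mapping.single (Poly_Mapping.single x 1) 1 else 0)"
    unfolding linear_form_def by (rule sum.cong) (auto simp: axis_def)
  then show ?thesis by simp
qed

lemma hpart_linear_form: "hpart 1 (linear_form a) = linear_form a"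
  by (simp add: linear_form_def hpart_sum hpart_single)

lemma ev_linear_form: "ev w (linear_form a) = (\<Sum>x\<in>UNIV. [:a $ x:] * w x)"
proof -
  have "(\<Prod>y\<in>UNIV. w y ^ Poly_Mapping.lookup (Poly_Mapping.single x 1) y) = w x" for x
  proof -
    have "(\<Prod>y\<in>UNIV. w y ^ Poly_Mapping.lookup (Poly_Mapping.single x 1) y) =
        (\<Prod>y\<in>UNIV. if y = x then w x else 1)"
      by (rule prod.cong) (auto simp: lookup_single when_def)
    then show ?thesis by simp
  qed
  then show ?thesis by (simp add: linear_form_def ev.sum ev_single)
qed

lemma ev_line:
  fixes p q :: "'k::field ^ 'x::finite"
  shows "ev (\<lambda>x. [:p $ x, q $ x:]) (linear_form a) = [:dot a p, dot a q:]"
proof -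
  have "(\<Sum>x\<in>A. [:f x, g x:]) = [:\<Sum>x\<in>A. f x, \<Sum>x\<in>A. g x:]"
      for A :: "'x set" and f g :: "'x \<Rightarrow> 'k"
    by (induction A rule: infinite_finite_induct) simp_all
  then show ?thesis by (simp add: ev_linear_form dot_def mult.commute)
qed

text \<open>Evaluation along the line \<open>{t p}\<close> kills exactly the ideal of the
  projective point \<open>p\<close>; unlike evaluation at \<open>p\<close> itself it also separates the homogeneous parts.\<close>

abbreviation ev_pt :: "'k::field ^ 'x::finite \<Rightarrow> ('x, 'k) mpoly \<Rightarrow> 'k poly" where
  "ev_pt p \<equiv> ev (\<lambda>x. Polynomial.monom (p $ x) (Suc 0))"

lemma ev_pt_linear_form: "ev_pt p (linear_form a) = Polynomial.monom (dot a p) (Suc 0)"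
  by (simp add: ev_linear_form dot_def monom_sum smult_monom)

lemma ev_pt_single:
  fixes p :: "'k::field ^ 'x::finite"
  shows
  "ev_pt p (Poly_Mapping.single m c) =
     Polynomial.monom (c * (\<Prod>x\<in>UNIV. (p $ x) ^ Poly_Mapping.lookup m x)) (mdeg m)"
proof -
  have "(\<Prod>x\<in>A. Polynomial.monom (f x) (Suc 0) ^ g x)
      = Polynomial.monom (\<Prod>x\<in>A. f x ^ g x) (\<Sum>x\<in>A. g x)"
    for A :: "'x set" and f :: "'x \<Rightarrow> 'k" and g :: "'x \<Rightarrow> nat"
    by (induction A rule: infinite_finite_induct) (simp_all add: monom_power mult_monom)
  then show ?thesis by (simp add: ev_single mdeg_def smult_monom)
qed

text \<open>Each variable goes to a multiple of T, so degrees are kept. Hence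
  \<open>ev_pt p f = 0\<close> passes to every homogeneous part of \<open>f\<close>, which makes
  ideals of points graded.\<close>

lemma ev_pt_hpart: "ev_pt p (hpart d f) = Polynomial.monom (Polynomial.coeff (ev_pt p f) d) d"
proof -
  have single: "ev_pt p (hpart d (Poly_Mapping.single m c)) =
      Polynomial.monom (Polynomial.coeff (ev_pt p (Poly_Mapping.single m c)) d) d" for m c
    by (cases "mdeg m = d") (simp_all add: hpart_single ev_pt_single ev.zero)
  have "ev_pt p (hpart d f) = (\<Sum>m\<in>Poly_Mapping.keys f.
      ev_pt p (hpart d (Poly_Mapping.single m (Poly_Mapping.lookup f m))))"
    by (subst (1) poly_mapping_sum_single[of f]) (simp only: hpart_sum ev.sum)
  also have "\<dots> = Polynomial.monom (Polynomial.coeff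
      (\<Sum>m\<in>Poly_Mapping.keys f. ev_pt p (Poly_Mapping.single m (Poly_Mapping.lookup f m))) d) d"
    by (simp only: single coeff_sum monom_sum)
  also have "\<dots> = Polynomial.monom (Polynomial.coeff (ev_pt p f) d) d"
    by (simp only: ev.sum[symmetric] poly_mapping_sum_single[symmetric])
  finally show ?thesis .
qed

lemma single_eq_prod_var:
  "Poly_Mapping.single m c = Poly_Mapping.single 0 c *
     (\<Prod>x\<in>UNIV. (var x :: ('x::finite, 'k::field) mpoly) ^ Poly_Mapping.lookup m x)"
proof -
  have pow: "(var x :: ('x, 'k) mpoly) ^ k = Poly_Mapping.single (Poly_Mapping.single x k) 1" for x k
    by (induction k) (simp_all add: mult_single single_add[symmetric])
  have prod: "(\<Prod>x\<in>A. Poly_Mapping.single (g x) (1 :: 'k))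
      = Poly_Mapping.single (\<Sum>x\<in>A. g x) 1"
    for A :: "'x set" and g :: "'x \<Rightarrow> 'x \<Rightarrow>\<^sub>0 nat"
    by (induction A rule: infinite_finite_induct) (simp_all add: mult_single)
  have "(\<Sum>x\<in>UNIV. Poly_Mapping.single x (Poly_Mapping.lookup m x)) = m"
    by (rule poly_mapping_eqI) (simp add: lookup_sum lookup_single when_def)
  then show ?thesis by (simp only: pow prod mult_single add_0 mult_1_right)
qed

section \<open>The ideal of a projective point\<close>

definition zeros :: "('k::field ^ 'x::finite) set \<Rightarrow> ('k ^ 'x) set" where
  "zeros A = {q. \<forall>a\<in>A. dot a q = 0}"

text \<open>Double annihilator: a form outside the span of \<open>A\<close> would be nonzero at some
  common zero of \<open>A\<close>, but those are multiples of \<open>p\<close>, where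
  \<open>b\<close> vanishes.\<close>

lemma dot_eq_0_imp_in_span:
  assumes "zeros A = vec.span {p}" "dot b p = 0"
  shows "b \<in> vec.span A"
proof (rule ccontr)
  assume "b \<notin> vec.span A"
  then obtain w where w: "\<And>u. u \<in> A \<Longrightarrow> dot u w = 0" "dot b w = 1"
    by (rule not_in_span_imp_dot) blast
  then have "w \<in> vec.span {p}" using assms(1) by (auto simp: zeros_def)
  then obtain c where "w = c *s p" by (auto simp: vec.span_singleton)
  then show False using w(2) assms(2) by (simp add: dot_scale_right)
qed

lemma ideal_generated_eq: "ideal_generated S = rg.span S"
  by (simp add: ideal_generated_def)

text \<open>For the converse choose a form L with L(p) = 1. The form x - p_x L vanishes at
  \<open>p\<close> and so lies in the ideal. Modulo the ideal every variable is thus p_x L, and the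
  part of degree d of \<open>f\<close> is its value at \<open>p\<close> times L^d.\<close>

lemma ideal_linear_forms_iff:
  fixes p :: "'k::field ^ 'x::finite"
  assumes "p \<noteq> 0" and z: "zeros A = vec.span {p}"
  shows "f \<in> ideal_generated (linear_form ` A) \<longleftrightarrow> ev_pt p f = 0"
proof
  assume "f \<in> ideal_generated (linear_form ` A)"
  moreover have "linear_form ` A \<subseteq> {f. ev_pt p f = 0}"
  proof clarify
    fix a assume "a \<in> A"
    moreover have "p \<in> zeros A" unfolding z by (simp add: vec.span_base)
    ultimately show "ev_pt p (linear_form a) = 0" by (simp add: zeros_def ev_pt_linear_form)
  qed
  then have "ideal_generated (linear_form ` A) \<subseteq> {f. ev_pt p f = 0}"
    unfolding ideal_generated_eq
    by (rule rg.span_minimal) (auto simp: rg.subspace_def ev.zero ev.add ev_mult)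
  ultimately show "ev_pt p f = 0" by blast
next
  let ?J = "ideal_generated (linear_form ` A)"
  have J: "rg.subspace ?J" unfolding ideal_generated_eq by (rule rg.subspace_span)
  obtain L where L: "dot L p = 1" using ex_dot_eq_1[OF assms(1)] by blast
  let ?L = "linear_form L"
  have lin: "linear_form b \<in> ?J" if "dot b p = 0" for b
  proof -
    have "vec.subspace {b. linear_form b \<in> ?J}"
      unfolding vec.subspace_def using J
      by (auto simp: linear_form_zero linear_form_add linear_form_scale rg.subspace_0
          rg.subspace_add rg.subspace_scale)
    moreover have "A \<subseteq> {b. linear_form b \<in> ?J}"
      by (auto simp: ideal_generated_eq intro: rg.span_base)
    ultimately have "vec.span A \<subseteq> {b. linear_form b \<in> ?J}" by (intro vec.span_minimal)
    then show ?thesis using dot_eq_0_imp_in_span[OF z that] by blast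
  qed
  have mult: "u * u' - v * v' \<in> ?J" if "u - v \<in> ?J" "u' - v' \<in> ?J" for u v u' v'
  proof -
    have "u * (u' - v') + v' * (u - v) \<in> ?J"
      using that J by (intro rg.subspace_add rg.subspace_scale)
    then show ?thesis by (simp add: algebra_simps)
  qed
  have power: "u ^ k - v ^ k \<in> ?J" if "u - v \<in> ?J" for u v k
    by (induction k) (use that mult rg.subspace_0[OF J] in auto)
  have prod: "(\<Prod>x\<in>X. g x) - (\<Prod>x\<in>X. h x) \<in> ?J" if "\<And>x. g x - h x \<in> ?J"
    for X :: "'x set" and g h
    by (induction X rule: infinite_finite_induct) (use that mult rg.subspace_0[OF J] in auto)
  have var: "var x - Poly_Mapping.single 0 (p $ x) * ?L \<in> ?J" for x
  proof -
    have "linear_form (axis x 1 - p $ x *s L) \<in> ?J"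
      by (rule lin) (simp add: dot_diff_left dot_axis dot_scale_left L)
    then show ?thesis by (simp only: linear_form_diff linear_form_axis linear_form_scale)
  qed
  have mono: "Poly_Mapping.single m c - Poly_Mapping.single 0 (Polynomial.coeff (ev_pt p
      (Poly_Mapping.single m c)) (mdeg m)) * ?L ^ mdeg m \<in> ?J"
    for m c
  proof -
    have const: "(\<Prod>x\<in>X. (Poly_Mapping.single 0 (g x) :: ('x, 'k) mpoly) ^ h x)
        = Poly_Mapping.single 0 (\<Prod>x\<in>X. g x ^ h x)"
      for X :: "'x set" and g :: "'x \<Rightarrow> 'k" and h
    proof (induction X rule: infinite_finite_induct)
      case (insert x X)
      have "(Poly_Mapping.single 0 c :: ('x, 'k) mpoly) ^ k = Poly_Mapping.single 0 (c ^ k)" for c k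
        by (induction k) (simp_all add: mult_single)
      then show ?case using insert by (simp add: mult_single)
    qed simp_all
    have "(\<Prod>x\<in>UNIV. (var x :: ('x, 'k) mpoly) ^ Poly_Mapping.lookup m x) -
        (\<Prod>x\<in>UNIV. (Poly_Mapping.single 0 (p $ x) * ?L) ^ Poly_Mapping.lookup m x) \<in> ?J"
      by (intro prod power var)
    then have "Poly_Mapping.single 0 c * ((\<Prod>x\<in>UNIV. var x ^ Poly_Mapping.lookup m x) -
        (\<Prod>x\<in>UNIV. (Poly_Mapping.single 0 (p $ x) * ?L) ^ Poly_Mapping.lookup m x)) \<in> ?J"
      using J by (intro rg.subspace_scale)
    moreover have "(\<Prod>x\<in>UNIV. (Poly_Mapping.single 0 (p $ x) * ?L) ^ Poly_Mapping.lookup m x) =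
        Poly_Mapping.single 0 (\<Prod>x\<in>UNIV. (p $ x) ^ Poly_Mapping.lookup m x) * ?L ^ mdeg m"
      by (simp add: power_mult_distrib prod.distrib const mdeg_def power_sum)
    ultimately show ?thesis
      by (simp add: ev_pt_single right_diff_distrib mult_single flip: single_eq_prod_var mult.assoc)
  qed
  assume f0: "ev_pt p f = 0"
  have part: "hpart d f \<in> ?J" for d
  proof -
    let ?h = "hpart d f"
    let ?s = "\<lambda>m. Poly_Mapping.single m (Poly_Mapping.lookup ?h m)"
    have "(\<Sum>m\<in>Poly_Mapping.keys ?h. ?s m -
        Poly_Mapping.single 0 (Polynomial.coeff (ev_pt p (?s m)) (mdeg m)) * ?L ^ mdeg m) \<in> ?J"
      using J mono by (intro rg.subspace_sum)
    also have "(\<Sum>m\<in>Poly_Mapping.keys ?h. ?s m -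
        Poly_Mapping.single 0 (Polynomial.coeff (ev_pt p (?s m)) (mdeg m)) * ?L ^ mdeg m) =
        (\<Sum>m\<in>Poly_Mapping.keys ?h. ?s m -
        Poly_Mapping.single 0 (Polynomial.coeff (ev_pt p (?s m)) d) * ?L ^ d)"
    proof (rule sum.cong)
      fix m assume "m \<in> Poly_Mapping.keys ?h"
      then have "mdeg m = d" by (intro hpart_eq_self_keys[of d ?h]) (simp_all add: hpart_hpart)
      then show "?s m - Poly_Mapping.single 0 (Polynomial.coeff (ev_pt p (?s m)) (mdeg m))
          * ?L ^ mdeg m =
          ?s m - Poly_Mapping.single 0 (Polynomial.coeff (ev_pt p (?s m)) d) * ?L ^ d" by simp
    qed simp
    also have "\<dots> = ?h - Poly_Mapping.single 0 (Polynomial.coeff (ev_pt p ?h) d) * ?L ^ d"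
    proof -
      have single_sum: "Poly_Mapping.single 0 (\<Sum>m\<in>X. g m)
          = (\<Sum>m\<in>X. Poly_Mapping.single 0 (g m))"
        for X :: "('x \<Rightarrow>\<^sub>0 nat) set" and g :: "_ \<Rightarrow> 'k"
        by (induction X rule: infinite_finite_induct) (simp_all add: single_add)
      have "Polynomial.coeff (ev_pt p ?h) d = (\<Sum>m\<in>Poly_Mapping.keys ?h. Polynomial.coeff
          (ev_pt p (?s m)) d)"
        by (simp only: ev.sum[symmetric] coeff_sum[symmetric] poly_mapping_sum_single[symmetric])
      then show ?thesis
        by (simp add: sum_subtractf single_sum sum_distrib_right flip: poly_mapping_sum_single)
    qed
    finally show ?thesis using f0 by (simp add: ev_pt_hpart)
  qed
  obtain N where "f = (\<Sum>d<N. hpart d f)" using sum_hpart by blast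
  then show "f \<in> ?J" using part rg.subspace_sum[OF J] by metis
qed

section \<open>Star configurations\<close>

text \<open>Along an enumeration of the variables, exponents become lists of fixed length with sum
  \<open>d\<close>. The upper bound suffices, as the independent families below attain it.\<close>

lemma card_monomials_le:
  "card (monomials d :: ('x::finite \<Rightarrow>\<^sub>0 nat) set) \<le> (d + CARD('x) - 1) choose d"
proof -
  let ?N = "CARD('x)"
  let ?L = "{l :: nat list. size l = ?N \<and> sum_list l = d}"
  obtain h where h: "bij_betw h {0..<?N} (UNIV :: 'x set)"
    using ex_bij_betw_nat_finite[of "UNIV :: 'x set"] by auto
  define f where "f m = map (\<lambda>i. Poly_Mapping.lookup m (h i)) [0..<?N]"
      for m :: "'x \<Rightarrow>\<^sub>0 nat"
  have "card ?L = (d + ?N - 1) choose d" by (rule card_length_sum_list)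
  moreover have "d \<le> d + ?N - 1" using zero_less_card_finite[where 'a = 'x] by linarith
  ultimately have fin: "finite ?L" by (metis card_ge_0_finite zero_less_binomial)
  have "f ` monomials d \<subseteq> ?L"
  proof clarify
    fix m :: "'x \<Rightarrow>\<^sub>0 nat"
    have "sum_list (f m) = (\<Sum>i\<in>{0..<?N}. Poly_Mapping.lookup m (h i))"
      by (simp add: f_def interv_sum_list_conv_sum_set_nat)
    also have "\<dots> = mdeg m"
      unfolding mdeg_def by (rule sum.reindex_bij_betw[OF h])
    finally show "length (f m) = ?N \<and> sum_list (f m) = mdeg m" by (simp add: f_def)
  qed
  moreover have "inj_on f (monomials d)"
  proof (rule inj_onI, rule poly_mapping_eqI)
    fix m m' x assume "f m = f m'"
    moreover have "x \<in> h ` {0..<?N}" using h by (simp add: bij_betw_def)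
    then obtain i where "i < ?N" "x = h i" by auto
    ultimately show "Poly_Mapping.lookup m x = Poly_Mapping.lookup m' x"
      by (auto simp: f_def)
  qed
  ultimately show ?thesis
    using card_inj_on_le[OF _ _ fin] card_length_sum_list[of ?N d] by metis
qed

lemma hpart_prod_linear_form:
  "finite A \<Longrightarrow> hpart (card A) (\<Prod>i\<in>A. linear_form (f i))
      = (\<Prod>i\<in>A. linear_form (f i))"
proof (induction A rule: finite_induct)
  case empty
  then show ?case by (simp add: hpart_single flip: single_one)
next
  case (insert i A)
  then show ?case
    using hpart_mult_homogeneous[OF hpart_linear_form insert.IH] by simp
qed

text \<open>Evaluation leaves a single term. The alternative \<open>u \<tau> = 0\<close> admits
  terms that do not vanish under \<open>w\<close> but were eliminated before.\<close>

lemma coeff_eq_0_by_ev: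
  assumes "finite A" "\<sigma> \<in> A" "\<And>\<tau>. \<tau> \<in> A
      \<Longrightarrow> \<tau> \<noteq> \<sigma> \<Longrightarrow> u \<tau>
          = 0 \<or> ev w (F \<tau>) = 0" "ev w (F \<sigma>) \<noteq> 0"
    and "ev w (\<Sum>\<tau>\<in>A. Poly_Mapping.single 0 (u \<tau>) * F \<tau>) = 0"
  shows "u \<sigma> = 0"
proof -
  have "ev w (\<Sum>\<tau>\<in>A. Poly_Mapping.single 0 (u \<tau>) * F \<tau>)
      = (\<Sum>\<tau>\<in>A. [:u \<tau>:] * ev w (F \<tau>))"
    by (simp add: ev.sum ev_mult ev_const)
  also have "\<dots> = (\<Sum>\<tau>\<in>A. if \<tau>
      = \<sigma> then [:u \<sigma>:] * ev w (F \<sigma>) else 0)"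
    by (rule sum.cong) (use assms(3) in auto)
  also have "\<dots> = [:u \<sigma>:] * ev w (F \<sigma>)" using assms(1,2) by simp
  finally show ?thesis using assms(4,5) by simp
qed

lemma finite_nsets: "finite V \<Longrightarrow> finite (nsets V k)"
  by (simp add: nsets_def)

lemma card_nsets_eq: "finite V \<Longrightarrow> card (nsets V k) = card V choose k"
proof -
  assume "finite V"
  moreover from this have "nsets V k = {N. N \<subseteq> V \<and> card N = k}"
    by (auto simp: nsets_def intro: finite_subset)
  ultimately show ?thesis by (simp add: n_subsets)
qed

text \<open>\<open>meet_properly\<close> in terms of vectors: \<open>zeros_P\<close> says that the n
  forms cut out exactly the line through \<open>P \<sigma>\<close>, \<open>dot_P\<close> that no
  further hyperplane passes through this point.\<close>

locale star_configuration =
  fixes a :: "nat \<Rightarrow> 'k::field ^ 'x::finite" and n :: nat and V :: "nat set"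
    and P :: "nat set \<Rightarrow> 'k ^ 'x"
  assumes dim: "CARD('x) = n + 1" and n_pos: "0 < n" and fin: "finite V" and n_le: "n \<le> card V"
    and P_nonzero: "\<sigma> \<in> nsets V n \<Longrightarrow> P \<sigma> \<noteq> 0"
    and zeros_P: "\<sigma> \<in> nsets V n \<Longrightarrow> zeros (a ` \<sigma>)
        = vec.span {P \<sigma>}"
    and dot_P: "\<sigma> \<in> nsets V n \<Longrightarrow> i \<in> V - \<sigma>
        \<Longrightarrow> dot (a i) (P \<sigma>) \<noteq> 0"
begin

text \<open>This is F_b on n-subsets and G_S on (n - 1)-subsets; \<open>normal\<close> below
  supplies L_b.\<close>

definition form_off :: "nat set \<Rightarrow> ('x, 'k) mpoly" where
  "form_off \<tau> = (\<Prod>i\<in>V - \<tau>. linear_form (a i))"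

definition normal :: "nat set \<Rightarrow> 'k ^ 'x" where
  "normal \<sigma> = (SOME b. dot b (P \<sigma>) = 1)"

definition faces :: "nat set set" where
  "faces = nsets V n \<union> nsets V (n - 1)"

text \<open>L_b F_b on n-subsets and G_S on (n - 1)-subsets: the whole basis of degree v - n + 1 as
  one family over \<open>faces\<close>.\<close>

definition face_form :: "nat set \<Rightarrow> ('x, 'k) mpoly" where
  "face_form \<tau> = (if card \<tau> = n then linear_form (normal \<tau>)
      * form_off \<tau> else form_off \<tau>)"

lemma dot_normal: "\<sigma> \<in> nsets V n \<Longrightarrow> dot (normal \<sigma>) (P \<sigma>) = 1"
  unfolding normal_def by (rule someI_ex) (rule ex_dot_eq_1[OF P_nonzero])

lemma dot_P_eq_0: "\<sigma> \<in> nsets V n \<Longrightarrow> i \<in> \<sigma>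
    \<Longrightarrow> dot (a i) (P \<sigma>) = 0"
  using zeros_P[of \<sigma>] vec.span_base[of "P \<sigma>" "{P \<sigma>}"] by (auto simp: zeros_def)

lemma point_ideal_iff:
  assumes "\<sigma> \<in> nsets V n"
  shows "f \<in> point_ideal a \<sigma> \<longleftrightarrow> ev_pt (P \<sigma>) f = 0"
  using ideal_linear_forms_iff[OF P_nonzero[OF assms] zeros_P[OF assms], of f]
  by (simp add: point_ideal_def image_image)

lemma ev_form_off_eq_0_iff: "ev w (form_off \<tau>) = 0
    \<longleftrightarrow> (\<exists>i\<in>V - \<tau>. ev w (linear_form (a i)) = 0)"
  using fin by (simp add: form_off_def ev_prod)

lemma ev_pt_form_off_eq_0_iff:
  assumes "\<sigma> \<in> nsets V n"
  shows "ev_pt (P \<sigma>) (form_off \<tau>) = 0 \<longleftrightarrow> \<not> \<sigma>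
      \<subseteq> \<tau>"
  using assms dot_P[OF assms] dot_P_eq_0[OF assms]
  by (auto simp: ev_form_off_eq_0_iff ev_pt_linear_form nsets_def)

lemma faces_subset_imp_eq:
  assumes "\<sigma> \<in> nsets V n" "\<tau> \<in> faces" "\<sigma> \<subseteq> \<tau>"
  shows "\<sigma> = \<tau>"
proof -
  have "finite \<tau>" "card \<tau> \<le> n" "card \<sigma> = n" using assms
      by (auto simp: faces_def nsets_def)
  then show ?thesis using assms(3) card_seteq by metis
qed

text \<open>A product of the forms off \<open>\<tau>\<close> survives at \<open>P \<sigma>\<close>
  only if \<open>\<sigma>\<close> lies in \<open>\<tau>\<close>, and n is the largest size of a
  face. So every G_S vanishes at every point.\<close>

lemma ev_pt_face_form_eq_0_iff:
  assumes "\<sigma> \<in> nsets V n" "\<tau> \<in> faces"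
  shows "ev_pt (P \<sigma>) (face_form \<tau>) = 0 \<longleftrightarrow> \<tau> \<noteq> \<sigma>"
proof (cases "\<tau> = \<sigma>")
  case True
  then show ?thesis
    using assms by (auto simp: face_form_def nsets_def ev_mult ev_pt_form_off_eq_0_iff
        ev_pt_linear_form dot_normal)
next
  case False
  then have "\<not> \<sigma> \<subseteq> \<tau>" using faces_subset_imp_eq assms by blast
  then show ?thesis
    using False assms by (simp add: face_form_def ev_mult ev_pt_form_off_eq_0_iff)
qed

lemma hpart_form_off:
  assumes "\<tau> \<subseteq> V"
  shows "hpart (card V - card \<tau>) (form_off \<tau>) = form_off \<tau>"
  using hpart_prod_linear_form[of "V - \<tau>" a] fin assms
  by (simp add: form_off_def card_Diff_subset finite_subset)

lemma hpart_form_off_nsets: "\<sigma> \<in> nsets V n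
    \<Longrightarrow> hpart (card V - n) (form_off \<sigma>) = form_off \<sigma>"
  using hpart_form_off[of \<sigma>] by (auto simp: nsets_def)

lemma hpart_face_form:
  assumes "\<tau> \<in> faces"
  shows "hpart (card V - n + 1) (face_form \<tau>) = face_form \<tau>"
proof (cases "card \<tau> = n")
  case True
  then have "\<tau> \<in> nsets V n" using assms n_pos by (auto simp: faces_def nsets_def)
  then show ?thesis
    using True hpart_mult_homogeneous[OF hpart_linear_form hpart_form_off_nsets, of \<tau>]
    by (simp add: face_form_def)
next
  case False
  then have "\<tau> \<subseteq> V" "card \<tau> = n - 1" using assms by (auto simp: faces_def nsets_def)
  moreover have "card V - (n - 1) = card V - n + 1" using n_pos n_le by linarith
  ultimately show ?thesis using False hpart_form_off[of \<tau>] by (simp add: face_form_def)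
qed

lemma finite_faces: "finite faces"
  by (simp add: faces_def finite_nsets fin)

text \<open>The hyperplanes through an \<open>(n - 1)\<close>-subset meet in a line not contained
  in any other hyperplane. Over a small field the line may have no point off the other hyperplanes, so it is
  parametrised by polynomials.\<close>

lemma line_exists:
  assumes S: "S \<in> nsets V (n - 1)"
  obtains w where "\<And>i. i \<in> S \<Longrightarrow> ev w (linear_form (a i)) = 0"
    "\<And>i. i \<in> V - S \<Longrightarrow> ev w (linear_form (a i)) \<noteq> 0"
proof -
  have S': "S \<subseteq> V" "finite S" "card S = n - 1" using S by (auto simp: nsets_def)
  have ins: "insert i S \<in> nsets V n" if "i \<in> V - S" for i
    using that S' n_pos by (auto simp: nsets_def)
  have "S \<noteq> V" using S' n_pos n_le by auto
  then obtain j where j: "j \<in> V - S" using S' by blast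
  \<comment> \<open>\<open>p\<close> is where hyperplane \<open>j\<close> meets the line of
    \<open>S\<close>. Duality provides a second vector \<open>q\<close> with all forms of
    \<open>S\<close> zero, and p + T q is the parametrisation.\<close>
  define p where "p = P (insert j S)"
  have p: "p \<noteq> 0" "\<And>i. i \<in> insert j S \<Longrightarrow> dot (a i) p = 0"
    using P_nonzero[OF ins[OF j]] dot_P_eq_0[OF ins[OF j]] by (auto simp: p_def)
  have zp: "zeros (a ` insert j S) = vec.span {p}"
    unfolding p_def by (rule zeros_P[OF ins[OF j]])
  \<comment> \<open>The forms of \<open>insert j S\<close> span all forms vanishing at
    \<open>p\<close>. If \<open>a j\<close> were redundant, those of \<open>S\<close> and one form L
    with L(p) = 1 would span the dual space: n vectors for dimension n + 1.\<close>
  have "a j \<notin> vec.span (a ` S)"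
  proof
    assume aj: "a j \<in> vec.span (a ` S)"
    obtain L where L: "dot L p = 1" using ex_dot_eq_1[OF p(1)] by blast
    have "b \<in> vec.span (insert L (a ` S))" for b
    proof -
      have "b - dot b p *s L \<in> vec.span (a ` insert j S)"
        by (rule dot_eq_0_imp_in_span[OF zp]) (simp add: dot_diff_left dot_scale_left L)
      also have "vec.span (a ` insert j S) = vec.span (a ` S)"
        using aj by (simp add: vec.span_redundant)
      finally show ?thesis by (auto simp: vec.span_insert)
    qed
    then have "vec.dim (UNIV :: ('k ^ 'x) set) \<le> card (insert L (a ` S))"
      using S' by (intro vec.dim_le_card) auto
    also have "\<dots> \<le> Suc (card (a ` S))" using S' by (simp add: card_insert_if)
    also have "\<dots> \<le> n" using card_image_le[of S a] S' n_pos by linarith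
    finally show False using dim by (simp add: card_cart_basis)
  qed
  then obtain q where q: "\<And>u. u \<in> a ` S \<Longrightarrow> dot u q = 0" "dot (a j) q = 1"
    by (rule not_in_span_imp_dot) blast
  show thesis
  proof
    show "ev (\<lambda>x. [:p $ x, q $ x:]) (linear_form (a i)) = 0" if "i \<in> S" for i
      using that p q(1)[of "a i"] by (simp add: ev_line)
    \<comment> \<open>If form \<open>i\<close> vanished on the line, \<open>p\<close> and
      \<open>q\<close> would both be multiples of \<open>P (insert i S)\<close>. Form
      \<open>j\<close> is 0 at the nonzero \<open>p\<close>, hence also at \<open>q\<close>, where
      its value is 1.\<close>
    show "ev (\<lambda>x. [:p $ x, q $ x:]) (linear_form (a i)) \<noteq> 0" if i: "i \<in> V - S" for i
    proof
      assume "ev (\<lambda>x. [:p $ x, q $ x:]) (linear_form (a i)) = 0"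
      then have "dot (a i) p = 0" "dot (a i) q = 0" by (simp_all add: ev_line)
      then have "p \<in> zeros (a ` insert i S)" "q \<in> zeros (a ` insert i S)"
        using p q by (auto simp: zeros_def)
      then have "p \<in> vec.span {P (insert i S)}" "q \<in> vec.span {P (insert i S)}"
        using zeros_P[OF ins[OF i]] by auto
      then obtain c e where ce: "p = c *s P (insert i S)" "q = e *s P (insert i S)"
        by (auto simp: vec.span_singleton)
      then have "c \<noteq> 0" using p(1) by auto
      then have "dot (a j) (P (insert i S)) = 0" using p(2)[of j] ce by (simp add: dot_scale_right)
      then show False using q(2) ce by (simp add: dot_scale_right)
    qed
  qed
qed

section \<open>Bases of the forms of degrees v - n and v - n + 1\<close>

lemma face_form_independent:
  assumes "(\<Sum>\<tau>\<in>faces. Poly_Mapping.single 0 (u \<tau>) * face_form \<tau>)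
      = 0" "\<tau> \<in> faces"
  shows "u \<tau> = 0"
proof -
  have n: "u \<sigma> = 0" if "\<sigma> \<in> nsets V n" for \<sigma>
    by (rule coeff_eq_0_by_ev[OF finite_faces, where F = face_form and w
        = "\<lambda>x. Polynomial.monom (P \<sigma> $ x) (Suc 0)"])
      (use that assms(1) in \<open>auto simp: ev_pt_face_form_eq_0_iff ev.zero faces_def\<close>)
  show ?thesis
  proof (cases "\<tau> \<in> nsets V n")
    case False
    then have S: "\<tau> \<in> nsets V (n - 1)" using assms(2) by (simp add: faces_def)
    obtain w where w: "\<And>i. i \<in> \<tau> \<Longrightarrow> ev w (linear_form (a i)) = 0"
      "\<And>i. i \<in> V - \<tau> \<Longrightarrow> ev w (linear_form (a i)) \<noteq> 0"
      using line_exists[OF S] by blast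
    have small: "card \<tau>' \<noteq> n" if "\<tau>' \<in> nsets V (n - 1)" for \<tau>'
      using that n_pos by (auto simp: nsets_def)
    show ?thesis
    proof (rule coeff_eq_0_by_ev[OF finite_faces assms(2), where F = face_form and w = w])
      show "ev w (face_form \<tau>) \<noteq> 0"
        using w small[OF S] by (auto simp: face_form_def ev_form_off_eq_0_iff)
      show "ev w (\<Sum>\<tau>\<in>faces. Poly_Mapping.single 0 (u \<tau>) * face_form \<tau>) = 0"
        using assms(1) by (simp add: ev.zero)
      fix \<tau>' assume \<tau>': "\<tau>' \<in> faces" "\<tau>' \<noteq> \<tau>"
      show "u \<tau>' = 0 \<or> ev w (face_form \<tau>') = 0"
      proof (cases "\<tau>' \<in> nsets V n")
        case False
        then have S': "\<tau>' \<in> nsets V (n - 1)" using \<tau>' by (simp add: faces_def)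
        \<comment> \<open>The factor of an \<open>i\<close> in \<open>\<tau> - \<tau>'\<close>
          vanishes on the line of \<open>\<tau>\<close>, so only \<open>\<tau>\<close> itself
          survives there.\<close>
        then have "\<not> \<tau> \<subseteq> \<tau>'"
            using S \<tau>'(2) card_seteq[of \<tau>' \<tau>] by (auto simp: nsets_def)
        then obtain i where "i \<in> \<tau>" "i \<notin> \<tau>'" by blast
        moreover from this have "i \<in> V" using S by (auto simp: nsets_def)
        ultimately show ?thesis
          using w(1) small[OF S'] by (auto simp: face_form_def ev_form_off_eq_0_iff)
      qed (simp add: n)
    qed
  qed (rule n)
qed

lemma form_off_independent:
  assumes "(\<Sum>\<sigma>\<in>nsets V n. Poly_Mapping.single 0 (u \<sigma>) * form_off \<sigma>)
      = 0" "\<sigma> \<in> nsets V n"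
  shows "u \<sigma> = 0"
proof (rule coeff_eq_0_by_ev[where F = form_off and A = "nsets V n" and w
    = "\<lambda>x. Polynomial.monom (P \<sigma> $ x) (Suc 0)"])
  fix \<tau> assume "\<tau> \<in> nsets V n" "\<tau> \<noteq> \<sigma>"
  then have "\<not> \<sigma> \<subseteq> \<tau>"
      using faces_subset_imp_eq[of \<sigma> \<tau>] assms(2) by (auto simp: faces_def)
  then show "u \<tau> = 0 \<or> ev_pt (P \<sigma>) (form_off \<tau>) = 0"
    using assms(2) by (simp add: ev_pt_form_off_eq_0_iff)
qed (use assms fin in \<open>auto simp: ev_pt_form_off_eq_0_iff ev.zero finite_nsets\<close>)

text \<open>The binomial coefficient bounds the number of monomials of degree \<open>d\<close> in n
  + 1 variables, so an independent family of this size leaves no room for another form.\<close>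

lemma independent_family_spans_degree:
  assumes "finite A" "\<And>i. i \<in> A \<Longrightarrow> hpart d (F i) = (F i :: ('x, 'k) mpoly)"
    and "\<And>u i. (\<Sum>i\<in>A. Poly_Mapping.single 0 (u i) * F i) = 0 \<Longrightarrow> i
        \<in> A \<Longrightarrow> u i = 0"
    and "card A = (d + n) choose d"
  shows "inj_on F A" "rg.vs.independent (F ` A)" "rg.graded_piece UNIV d \<subseteq> rg.vs.span (F ` A)"
proof -
  have ind: "inj_on F A \<and> F ` A \<inter> {} = {} \<and> rg.vs.independent ({} \<union> F ` A)"
    by (rule rg.vs.independent_Un_family[OF rg.vs.independent_empty finite.emptyI assms(1)])
      (use assms(3) in simp)
  then show inj: "inj_on F A" and indep: "rg.vs.independent (F ` A)" by auto
  let ?T = "(\<lambda>m. Poly_Mapping.single m (1 :: 'k)) ` (monomials d ::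
      ('x \<Rightarrow>\<^sub>0 nat) set)"
  have "card ?T \<le> card (monomials d :: ('x \<Rightarrow>\<^sub>0 nat) set)"
    by (rule card_image_le[OF finite_monomials])
  also have "\<dots> \<le> card (F ` A)"
    using card_monomials_le[where 'x = 'x, of d] inj assms(4) dim by (simp add: card_image)
  finally have "card ?T \<le> card (F ` A)" .
  moreover have "F ` A \<subseteq> rg.vs.span ?T"
    using assms(2) ring_graded_piece_subset_span[of UNIV d] by (force simp: rg.graded_piece_def)
  ultimately have "rg.vs.span ?T \<subseteq> rg.vs.span (F ` A)"
    using indep by (intro rg.vs.independent_card_ge_spans) (auto simp: finite_monomials)
  then show "rg.graded_piece UNIV d \<subseteq> rg.vs.span (F ` A)"
    using ring_graded_piece_subset_span by blast
qed

lemma card_faces: "card faces = (card V - n + 1 + n) choose (card V - n + 1)"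
proof -
  have "nsets V n \<inter> nsets V (n - 1) = {}" using n_pos by (auto simp: nsets_def)
  then have "card faces = (card V choose n) + (card V choose (n - 1))"
    by (simp add: faces_def card_Un_disjoint finite_nsets fin card_nsets_eq)
  also have "\<dots> = Suc (card V) choose n"
    using n_pos by (cases n) simp_all
  also have "\<dots> = Suc (card V) choose (Suc (card V) - n)"
    using n_le by (intro binomial_symmetric) simp
  finally show ?thesis using n_le by (simp add: Suc_diff_le)
qed

lemma face_form_basis:
  shows "inj_on face_form faces" "rg.vs.independent (face_form ` faces)"
    and "rg.graded_piece UNIV (card V - n + 1) \<subseteq> rg.vs.span (face_form ` faces)"
  by (rule independent_family_spans_degree[OF finite_faces _ _ card_faces];
      use hpart_face_form face_form_independent in blast)+

lemma form_off_spans: "rg.graded_piece UNIV (card V - n) \<subseteq> rg.vs.span (form_off ` nsets V n)"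
proof (rule independent_family_spans_degree(3))
  show "card (nsets V n) = (card V - n + n) choose (card V - n)"
    using n_le binomial_symmetric[of n "card V"] by (simp add: card_nsets_eq fin)
qed (use form_off_independent hpart_form_off_nsets in \<open>auto simp: finite_nsets fin\<close>)

section \<open>The ideal of the complementary configuration\<close>

context
  fixes B :: "nat set set" and I :: "('x, 'k) mpoly set"
  assumes B: "B \<subseteq> nsets V n"
    and disjoint: "\<And>b b'. b \<in> B \<Longrightarrow> b' \<in> B
        \<Longrightarrow> b \<noteq> b' \<Longrightarrow> nsets b (n - 1) \<inter> nsets b' (n - 1)
            = {}"
  defines "I \<equiv> configuration_ideal a (nsets V n - B)"
begin

lemma I_iff: "f \<in> I \<longleftrightarrow> (\<forall>\<sigma>\<in>nsets V n - B. ev_pt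
    (P \<sigma>) f = 0)"
  by (simp add: I_def configuration_ideal_def point_ideal_iff)

lemma graded_I: "rg.graded_submodule I"
  unfolding rg.graded_submodule_def rg.subspace_def
  by (auto simp: I_iff ev.zero ev.add ev_mult ev_pt_hpart)

lemma subspace_I: "rg.subspace I"
  using graded_I by (rule rg.graded_submoduleD)

text \<open>At \<open>P \<sigma>\<close> only \<open>form_off \<sigma>\<close> is nonzero, so
  vanishing there removes exactly the coefficient of \<open>\<sigma>\<close>.\<close>

lemma graded_piece_I_low: "rg.graded_piece I (card V - n) \<subseteq> rg.vs.span (form_off ` B)"
proof
  fix f assume f: "f \<in> rg.graded_piece I (card V - n)"
  then have "f \<in> rg.vs.span (form_off ` nsets V n)"
    using form_off_spans by (auto simp: rg.graded_piece_def)
  then obtain u where u: "f = (\<Sum>\<sigma>\<in>nsets V n. Poly_Mapping.single 0 (u \<sigma>)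
      * form_off \<sigma>)"
    by (rule rg.vs.span_image_family[OF finite_nsets[OF fin]])
  have u0: "u \<sigma> = 0" if \<sigma>: "\<sigma> \<in> nsets V n - B" for \<sigma>
  proof (rule coeff_eq_0_by_ev[where F = form_off and A = "nsets V n" and w
      = "\<lambda>x. Polynomial.monom (P \<sigma> $ x) (Suc 0)"])
    fix \<tau> assume "\<tau> \<in> nsets V n" "\<tau> \<noteq> \<sigma>"
    then have "\<not> \<sigma> \<subseteq> \<tau>"
        using faces_subset_imp_eq[of \<sigma> \<tau>] \<sigma> by (auto simp: faces_def)
    then show "u \<tau> = 0 \<or> ev_pt (P \<sigma>) (form_off \<tau>) = 0"
      using \<sigma> by (simp add: ev_pt_form_off_eq_0_iff)
  next
    show "ev_pt (P \<sigma>) (\<Sum>\<tau>\<in>nsets V n. Poly_Mapping.single 0 (u \<tau>)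
        * form_off \<tau>) = 0"
      using f \<sigma> unfolding u[symmetric] by (simp add: rg.graded_piece_def I_iff)
  qed (use \<sigma> fin in \<open>auto simp: ev_pt_form_off_eq_0_iff finite_nsets\<close>)
  have "f = (\<Sum>\<sigma>\<in>B. Poly_Mapping.single 0 (u \<sigma>) * form_off \<sigma>)"
    unfolding u using B u0 by (intro sum.mono_neutral_right) (auto simp: finite_nsets fin)
  then show "f \<in> rg.vs.span (form_off ` B)"
    by (simp only:) (intro rg.vs.span_sum rg.vs.span_scale rg.vs.span_base imageI)
qed

lemma form_off_in_I:
  assumes "b \<in> B"
  shows "form_off b \<in> rg.graded_piece I (card V - n)"
proof -
  have "\<not> \<sigma> \<subseteq> b" if "\<sigma> \<in> nsets V n - B" for \<sigma>
    using that faces_subset_imp_eq[of \<sigma> b] assms B by (auto simp: faces_def)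
  then show ?thesis
    using assms B hpart_form_off_nsets
    by (auto simp: rg.graded_piece_def I_iff ev_pt_form_off_eq_0_iff)
qed

text \<open>The G_S vanish at all points and belong to \<open>I\<close>; the points outside
  \<open>B\<close> remove only the coefficients of the corresponding L_b F_b.\<close>

lemma graded_piece_I: "rg.graded_piece I (card V - n + 1)
    = rg.vs.span (face_form ` (B \<union> nsets V (n - 1)))"
proof
  show "rg.graded_piece I (card V - n + 1) \<subseteq> rg.vs.span (face_form ` (B \<union> nsets V
      (n - 1)))"
  proof
    fix f assume f: "f \<in> rg.graded_piece I (card V - n + 1)"
    then have "f \<in> rg.vs.span (face_form ` faces)"
      using face_form_basis(3) by (auto simp: rg.graded_piece_def)
    then obtain u where u: "f = (\<Sum>\<sigma>\<in>faces. Poly_Mapping.single 0 (u \<sigma>)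
        * face_form \<sigma>)"
      by (rule rg.vs.span_image_family[OF finite_faces])
    have u0: "u \<sigma> = 0" if \<sigma>: "\<sigma> \<in> nsets V n - B" for \<sigma>
    proof (rule coeff_eq_0_by_ev[OF finite_faces, where F = face_form and w
        = "\<lambda>x. Polynomial.monom (P \<sigma> $ x) (Suc 0)"])
      show "ev_pt (P \<sigma>) (\<Sum>\<tau>\<in>faces. Poly_Mapping.single 0 (u \<tau>)
          * face_form \<tau>) = 0"
        using f \<sigma> unfolding u[symmetric] by (simp add: rg.graded_piece_def I_iff)
    qed (use \<sigma> in \<open>auto simp: ev_pt_face_form_eq_0_iff faces_def\<close>)
    have "f = (\<Sum>\<sigma>\<in>B \<union> nsets V (n - 1). Poly_Mapping.single 0 (u \<sigma>)
        * face_form \<sigma>)"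
      unfolding u using B u0 by (intro sum.mono_neutral_right finite_faces) (auto simp: faces_def)
    then show "f \<in> rg.vs.span (face_form ` (B \<union> nsets V (n - 1)))"
      by (simp only:) (intro rg.vs.span_sum rg.vs.span_scale rg.vs.span_base imageI)
  qed
  show "rg.vs.span (face_form ` (B \<union> nsets V (n - 1)))
      \<subseteq> rg.graded_piece I (card V - n + 1)"
  proof (rule rg.vs.span_minimal[OF _ rg.subspace_graded_piece[OF subspace_I]], clarify)
    fix \<tau> assume \<tau>: "\<tau> \<in> B \<union> nsets V (n - 1)"
    then have faces: "\<tau> \<in> faces" using B by (auto simp: faces_def)
    have "\<tau> \<noteq> \<sigma>" if "\<sigma> \<in> nsets V n - B" for \<sigma>
      using that \<tau> n_pos by (auto simp: nsets_def)
    then show "face_form \<tau> \<in> rg.graded_piece I (card V - n + 1)"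
      using hpart_face_form[OF faces] faces
      by (auto simp: rg.graded_piece_def I_iff ev_pt_face_form_eq_0_iff)
  qed
qed

text \<open>The forms of a block b span all linear forms that vanish at P_b, and
  \<open>normal b\<close> adds the one missing dimension. Hence every linear form times F_b is a
  combination of L_b F_b and the G_(b - i).\<close>

lemma decomposables_I:
  "rg.decomposables I (card V - n + 1) = rg.vs.span (face_form ` (B \<union>
      (\<Union>b\<in>B. nsets b (n - 1))))"
proof
  let ?S = "rg.vs.span (face_form ` (B \<union> (\<Union>b\<in>B. nsets b (n - 1))))"
  have bV: "b \<subseteq> V" "finite b" "card b = n" if "b \<in> B" for b
    using that B by (auto simp: nsets_def)
  have facet: "linear_form (a i) * form_off b = face_form (b - {i})" "b - {i} \<in> nsets b (n - 1)"
    if "b \<in> B" "i \<in> b" for b i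
  proof -
    have "V - (b - {i}) = insert i (V - b)" using bV that by auto
    moreover have "i \<notin> V - b" using that by simp
    ultimately have "form_off (b - {i}) = linear_form (a i) * form_off b"
      using fin by (simp add: form_off_def)
    moreover have "card (b - {i}) = n - 1" using bV[OF that(1)] that(2) by simp
    ultimately show "linear_form (a i) * form_off b = face_form (b - {i})" "b - {i}
        \<in> nsets b (n - 1)"
      using n_pos bV[OF that(1)] by (auto simp: face_form_def nsets_def)
  qed
  have lin: "linear_form c * form_off b \<in> ?S" if b: "b \<in> B" for b c
  proof -
    have bn: "b \<in> nsets V n" using b B by blast
    let ?U = "{c. linear_form c * form_off b \<in> ?S}"
    have "vec.subspace ?U"
      unfolding vec.subspace_def
    proof (intro conjI ballI allI; unfold mem_Collect_eq)
      show "linear_form 0 * form_off b \<in> ?S"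
        by (simp only: linear_form_zero mult_zero_left rg.vs.span_zero)
      show "linear_form (c + c') * form_off b \<in> ?S"
        if "linear_form c * form_off b \<in> ?S" "linear_form c' * form_off b \<in> ?S" for c c'
        using that unfolding linear_form_add distrib_right by (rule rg.vs.span_add)
      show "linear_form (r *s c) * form_off b \<in> ?S" if "linear_form c * form_off b \<in> ?S" for r c
        using that unfolding linear_form_scale mult.assoc by (rule rg.vs.span_scale)
    qed
    moreover have "normal b \<in> ?U"
    proof -
      have "face_form b \<in> ?S" using b by (intro rg.vs.span_base) blast
      then show ?thesis using bV[OF b] by (simp add: face_form_def)
    qed
    moreover have "a ` b \<subseteq> ?U"
      using facet[OF b] b by (auto intro!: rg.vs.span_base)
    ultimately have "vec.span (insert (normal b) (a ` b)) \<subseteq> ?U"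
      by (intro vec.span_minimal) auto
    moreover have "c - dot c (P b) *s normal b \<in> vec.span (a ` b)"
      by (rule dot_eq_0_imp_in_span[OF zeros_P[OF bn]])
        (simp add: dot_diff_left dot_scale_left dot_normal[OF bn])
    then have "c \<in> vec.span (insert (normal b) (a ` b))" by (auto simp: vec.span_insert)
    ultimately show ?thesis by blast
  qed
  show "rg.decomposables I (card V - n + 1) \<subseteq> ?S"
    unfolding rg.decomposables_def
  proof (rule rg.vs.span_minimal[OF _ rg.vs.subspace_span], clarify)
    fix x f e assume "card V - n + 1 = Suc e" "f \<in> rg.graded_piece I e"
    then have f: "f \<in> rg.vs.span (form_off ` B)" using graded_piece_I_low by auto
    have finB: "finite B" using B finite_nsets[OF fin] finite_subset by blast
    obtain u where u: "f = (\<Sum>b\<in>B. Poly_Mapping.single 0 (u b) * form_off b)"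
      by (rule rg.vs.span_image_family[OF finB f])
    have "var x * f = (\<Sum>b\<in>B. Poly_Mapping.single 0 (u b) * (linear_form (axis x 1)
        * form_off b))"
      unfolding u linear_form_axis sum_distrib_left
      by (rule sum.cong) (simp_all only: mult.left_commute)
    also have "\<dots> \<in> ?S" by (intro rg.vs.span_sum rg.vs.span_scale lin)
    finally show "var x * f \<in> ?S" .
  qed
  show "?S \<subseteq> rg.decomposables I (card V - n + 1)"
  proof (rule rg.vs.span_minimal)
    have dec: "linear_form c * form_off b \<in> rg.decomposables I (card V - n + 1)" if "b \<in> B"
        for b c
      by (rule rg.scale_in_decomposables[OF subspace_I form_off_in_I[OF that] hpart_linear_form]) simp
    show "face_form ` (B \<union> (\<Union>b\<in>B. nsets b (n - 1)))
        \<subseteq> rg.decomposables I (card V - n + 1)"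
    proof clarify
      fix \<tau> assume "\<tau> \<in> B \<union> (\<Union>b\<in>B. nsets b (n - 1))"
      then consider "\<tau> \<in> B" | b where "b \<in> B" "\<tau> \<in> nsets b (n - 1)" by blast
      then show "face_form \<tau> \<in> rg.decomposables I (card V - n + 1)"
      proof cases
        case 1
        then show ?thesis using dec[of \<tau>] bV[of \<tau>] by (simp add: face_form_def)
      next
        case 2
        then have "card (b - \<tau>) = 1" "\<tau> \<subseteq> b"
          using bV[of b] n_pos by (auto simp: nsets_def card_Diff_subset)
        then obtain i where "b - \<tau> = {i}" by (auto simp: card_1_singleton_iff)
        then have "i \<in> b" "\<tau> = b - {i}" using \<open>\<tau> \<subseteq> b\<close> by auto
        then show ?thesis using dec facet 2 by metis
      qed
    qed
    show "rg.vs.subspace (rg.decomposables I (card V - n + 1))"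
      unfolding rg.decomposables_def by (rule rg.vs.subspace_span)
  qed
qed

text \<open>Independence of the face forms turns dimensions into cardinalities. By
  \<open>disjoint\<close> the blocks contribute n |B| different (n - 1)-subsets, and the |B| forms
  L_b F_b occur in both dimensions and cancel.\<close>

lemma graded_betti_I: "graded_betti I 0 (card V - n + 1) + n * card B = card V choose (n - 1)"
proof -
  have finB: "finite B" using B finite_nsets[OF fin] finite_subset by blast
  have bV: "b \<subseteq> V" "finite b" "card b = n" if "b \<in> B" for b
    using that B by (auto simp: nsets_def)
  have dim: "rg.vs.dim (rg.vs.span (face_form ` A)) = card A" if "A \<subseteq> faces" for A
  proof -
    have "rg.vs.independent (face_form ` A)"
      by (rule rg.vs.independent_mono[OF face_form_basis(2)]) (use that in auto)
    moreover have "inj_on face_form A" using face_form_basis(1) that inj_on_subset by blast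
    ultimately show ?thesis by (simp add: rg.vs.dim_eq_card_independent card_image)
  qed
  let ?N = "\<Union>b\<in>B. nsets b (n - 1)"
  have NV: "?N \<subseteq> nsets V (n - 1)" using bV nsets_mono by blast
  have cardU: "card (B \<union> N) = card B + card N" if "N \<subseteq> nsets V (n - 1)" for N
  proof -
    have "B \<inter> N = {}" using B that n_pos by (force simp: nsets_def)
    moreover have "finite N" using that finite_nsets[OF fin] finite_subset by blast
    ultimately show ?thesis using finB by (intro card_Un_disjoint)
  qed
  have "card ?N = (\<Sum>b\<in>B. card (nsets b (n - 1)))"
    using finB bV disjoint by (intro card_UN_disjoint) (auto simp: finite_nsets)
  also have "\<dots> = (\<Sum>b\<in>B. n)"
  proof (rule sum.cong)
    fix b assume "b \<in> B"
    then have "card (nsets b (n - 1)) = n choose (n - 1)" using bV by (simp add: card_nsets_eq)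
    also have "\<dots> = n" using n_pos binomial_symmetric[of "n - 1" n] by simp
    finally show "card (nsets b (n - 1)) = n" .
  qed simp
  finally have cardN: "card ?N = n * card B" by simp
  have sub: "B \<union> nsets V (n - 1) \<subseteq> faces" "B \<union> ?N \<subseteq> faces"
    using B NV by (auto simp: faces_def)
  show ?thesis
    using graded_betti_0[OF graded_I, of "card V - n + 1"] dim[OF sub(1)] dim[OF sub(2)]
      cardU[OF NV] cardU[OF subset_refl] cardN
    unfolding graded_piece_I decomposables_I by (simp add: card_nsets_eq fin)
qed

end

end

section \<open>Steiner systems\<close>

lemma span_mem_hyperplane_iff:
  "p \<noteq> 0 \<Longrightarrow> vec.span {p} \<in> hyperplane b \<longleftrightarrow> dot b p = 0"
  using vec.span_base[of p "{p}"]
  by (auto simp: hyperplane_def projective_space_def vec.span_singleton dot_scale_right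
      simp flip: dot_def)

text \<open>The first half of \<open>meet_properly\<close> yields the points. The second keeps the
  other hyperplanes away: one through the point of \<open>\<sigma>\<close> would make n + 1
  hyperplanes concurrent.\<close>

lemma star_configuration_of_meet_properly:
  fixes a :: "nat \<Rightarrow> 'k::field ^ 'x::finite"
  assumes dim: "CARD('x) = n + 1" and "0 < n" "finite V" "n \<le> card V"
    and meet: "meet_properly n (\<lambda>i. hyperplane (a i)) V"
  obtains P where "star_configuration a n V P"
proof -
  have "\<exists>p. p \<noteq> 0 \<and> zeros (a ` \<sigma>)
      = vec.span {p} \<and> (\<forall>i\<in>V - \<sigma>. dot (a i) p \<noteq> 0)"
    if \<sigma>: "\<sigma> \<in> nsets V n" for \<sigma>
  proof -
    obtain Q where Q: "(\<Inter>i\<in>\<sigma>. hyperplane (a i)) = {Q}"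
      using meet \<sigma> by (auto simp: meet_properly_def)
    \<comment> \<open>An empty intersection would not be confined to projective points;
      \<open>0 < n\<close> excludes it.\<close>
    have "\<sigma> \<noteq> {}" using \<sigma> \<open>0 < n\<close> by (auto simp: nsets_def)
    then have "Q \<in> projective_space" using Q by (auto simp: hyperplane_def)
    then obtain p where p: "p \<noteq> 0" "Q = vec.span {p}" by (auto simp: projective_space_def)
    have zero: "dot (a i) p = 0" if "i \<in> \<sigma>" for i
      using Q that p span_mem_hyperplane_iff[OF p(1)] by blast
    have "zeros (a ` \<sigma>) = vec.span {p}"
    proof
      show "zeros (a ` \<sigma>) \<subseteq> vec.span {p}"
      proof
        fix q assume q: "q \<in> zeros (a ` \<sigma>)"
        show "q \<in> vec.span {p}"
        proof (cases "q = 0")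
          case False
          then have "vec.span {q} \<in> (\<Inter>i\<in>\<sigma>. hyperplane (a i))"
            using q by (auto simp: span_mem_hyperplane_iff zeros_def)
          then have "vec.span {q} = vec.span {p}" using Q p by simp
          then show ?thesis using vec.span_base[of q "{q}"] by simp
        qed (simp add: vec.span_zero)
      qed
      show "vec.span {p} \<subseteq> zeros (a ` \<sigma>)"
        using zero by (auto simp: zeros_def vec.span_singleton dot_scale_right)
    qed
    moreover have "dot (a i) p \<noteq> 0" if i: "i \<in> V - \<sigma>" for i
    proof
      assume "dot (a i) p = 0"
      then have "vec.span {p} \<in> (\<Inter>j\<in>insert i \<sigma>. hyperplane (a j))"
        using zero by (auto simp: span_mem_hyperplane_iff[OF p(1)])
      moreover have "insert i \<sigma> \<in> nsets V (n + 1)" using i \<sigma> by (auto simp: nsets_def)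
      ultimately show False using meet unfolding meet_properly_def by blast
    qed
    ultimately show ?thesis using p(1) by blast
  qed
  then obtain P where "\<forall>\<sigma>\<in>nsets V n. P \<sigma> \<noteq> 0 \<and> zeros
      (a ` \<sigma>) = vec.span {P \<sigma>} \<and>
      (\<forall>i\<in>V - \<sigma>. dot (a i) (P \<sigma>) \<noteq> 0)"
    by metis
  then have "star_configuration a n V P"
    using assms by unfold_locales auto
  then show thesis by (rule that)
qed

text \<open>A common \<open>s\<close>-subset would contain a \<open>t\<close>-subset lying in two
  blocks. The case s = n - 1 serves the Betti number, s = t the count of blocks.\<close>

lemma steiner_system_disjoint:
  assumes B: "steiner_system t n v B" and "t \<le> s" and b: "b \<in> B" "b' \<in> B" "b \<noteq> b'"
  shows "nsets b s \<inter> nsets b' s = {}"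
proof (rule ccontr)
  assume "nsets b s \<inter> nsets b' s \<noteq> {}"
  then obtain S where S: "S \<subseteq> b" "S \<subseteq> b'" "finite S" "card S = s"
      by (auto simp: nsets_def)
  then obtain T where T: "T \<subseteq> S" "card T = t" "finite T"
    using obtain_subset_with_card_n[of t S] \<open>t \<le> s\<close> by metis
  have "b \<subseteq> {1..v}" using B b by (auto simp: steiner_system_def nsets_def)
  then have "T \<in> nsets {1..v} t" using S T by (auto simp: nsets_def)
  then have "\<exists>!b. b \<in> B \<and> T \<subseteq> b" using B by (simp add: steiner_system_def)
  moreover have "T \<subseteq> b" "T \<subseteq> b'" using S T by auto
  ultimately show False using b by metis
qed

text \<open>The \<open>t\<close>-subsets of the blocks partition those of
  \<open>{1..v}\<close>.\<close>

lemma steiner_system_card: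
  assumes B: "steiner_system t n v B"
  shows "card B * (n choose t) = v choose t"
proof -
  have bn: "b \<subseteq> {1..v}" "finite b" "card b = n" if "b \<in> B" for b
    using B that by (auto simp: steiner_system_def nsets_def)
  have "finite B" using bn finite_subset[of B "Pow {1..v}"] by blast
  have "nsets {1..v} t = (\<Union>b\<in>B. nsets b t)"
  proof
    show "nsets {1..v} t \<subseteq> (\<Union>b\<in>B. nsets b t)"
    proof
      fix T assume T: "T \<in> nsets {1..v} t"
      then obtain b where "b \<in> B" "T \<subseteq> b" using B unfolding steiner_system_def by blast
      then show "T \<in> (\<Union>b\<in>B. nsets b t)" using T by (auto simp: nsets_def)
    qed
    show "(\<Union>b\<in>B. nsets b t) \<subseteq> nsets {1..v} t" using bn nsets_mono by blast
  qed
  then have "v choose t = card (\<Union>b\<in>B. nsets b t)"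
    using card_nsets_eq[of "{1..v}" t] by simp
  also have "\<dots> = (\<Sum>b\<in>B. card (nsets b t))"
    using \<open>finite B\<close> bn steiner_system_disjoint[OF B order_refl]
    by (intro card_UN_disjoint) (simp_all add: finite_nsets)
  also have "\<dots> = (\<Sum>b\<in>B. n choose t)"
    by (rule sum.cong) (simp_all add: bn card_nsets_eq)
  finally show ?thesis by simp
qed

text \<open>The difference is the negative of the one in the English statement: n |B| counts
  distinct (n - 1)-subsets, so it is at most choose(v, n - 1), and a Betti number is not negative.
  Real numbers avoid truncated subtraction and integer division.\<close>

theorem proposition4p4:
  fixes a :: "nat \<Rightarrow> 'k::field ^ 'x::finite"
    and t n v :: nat
    and B :: "nat set set"
  assumes "CARD('x) = n + 1"
    and "steiner_system t n v B"
    and "t < n" and "n \<le> v"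
    and "\<forall>i \<in> {1..v}. a i \<noteq> 0"
    and "inj_on (\<lambda>i. hyperplane (a i)) {1..v}"
    and "meet_properly n (\<lambda>i. hyperplane (a i)) {1..v}"
  shows "real (graded_betti (configuration_ideal a (nsets {1..v} n - B)) 0 (v - n + 1))
           = real (v choose (n - 1)) - real n * real (card B) \<and>
         real (v choose (n - 1)) - real n * real (card B)
           = real (v choose (n - 1)) - real n * (real (v choose t) / real (n choose t))"
proof -
  obtain P where "star_configuration a n {1..v} P"
    using star_configuration_of_meet_properly[OF assms(1) _ _ _ assms(7)] assms(3,4) by auto
  then interpret star_configuration a n "{1..v}" P .
  have "B \<subseteq> nsets {1..v} n" using assms(2) by (simp add: steiner_system_def)
  moreover have "nsets b (n - 1) \<inter> nsets b' (n - 1) = {}" if "b \<in> B" "b' \<in> B" "b \<noteq> b'" for b b'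
    using steiner_system_disjoint[OF assms(2) _ that] assms(3) by simp
  ultimately have "graded_betti (configuration_ideal a (nsets {1..v} n - B)) 0 (v - n + 1)
      + n * card B = v choose (n - 1)"
    using graded_betti_I[of B] by simp
  then have betti: "real (graded_betti (configuration_ideal a (nsets {1..v} n - B)) 0 (v - n + 1))
      + real n * real (card B) = real (v choose (n - 1))"
    by (simp flip: of_nat_mult of_nat_add)
  have "real (card B) * real (n choose t) = real (v choose t)"
    using steiner_system_card[OF assms(2)] by (simp flip: of_nat_mult)
  moreover have "real (n choose t) \<noteq> 0" using assms(3) by simp
  ultimately have "real (card B) = real (v choose t) / real (n choose t)"
    by (simp add: eq_divide_eq)
  then show ?thesis using betti by simp
qed

end
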